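(* Let $f \in C^3_{\rm per}(\mathbb{T})$ be an arbitrary odd function, not identically zero, such that $f''(x) \ge 0$ for all $x \in [0,\frac12]$. For $k>0$ let $u$ be the solution of the Cauchy problem for the viscous Burgers equation $$u_t + 2 u u_x = u_{xx}, \quad x\in\mathbb{T},\ t>0, \qquad u|_{t=0} = u_0, \quad u_0(x) = k f(x),$$ and denote the initial enstrophy by $\mathcal{E} = E(u_0)$, so that $\mathcal{E} = \mathcal{O}(k^2)$ as $k \to \infty$. Consider the limit $k\to\infty$ (equivalently $\mathcal{E}\to\infty$). Then there exists $T_* > 0$ (depending on $k$) such that the enstrophy $t \mapsto E(u(\cdot,t))$, $t \ge 0$, achieves its maximum at $t = T_*$, and with $u_* = u(\cdot,T_* )$, $$T_* = \mathcal{O}(\mathcal{E}^{-1/2}), \quad E(u_* ) = \mathcal{O}(\mathcal{E}^{3/2}), \quad K(u_* ) = \mathcal{O}(\mathcal{E}), \quad K(u_0) - K(u_* ) = \mathcal{O}(\mathcal{E}),$$ where all bounds are sharp as $\mathcal{E}\to\infty$. That is, there exist constants $k_0>0$ and $0<C_-<C_+<\infty$, depending only on $f$, such that for all $k \ge k_0$ such a $T_*$ exists and $$C_-\mathcal{E}^{-1/2} \le T_* \le C_+ \mathcal{E}^{-1/2}, \quad C_-\mathcal{E}^{3/2} \le E(u_* ) \le C_+ \mathcal{E}^{3/2},$$ $$C_-\mathcal{E} \le K(u_* ) \le C_+ \mathcal{E}, \quad C_-\mathcal{E} \le K(u_0)-K(u_* ) \le C_+ \mathcal{E}.$$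
   Context: $\mathbb{T} = [-\frac12,\frac12]$ is the unit circle with periodic boundary conditions (functions on $\mathbb{T}$ are identified with $1$-periodic functions on $\mathbb{R}$), and $C^3_{\rm per}(\mathbb{T})$ is the space of real-valued $1$-periodic $C^3$ functions. For such initial data the Cauchy problem has a unique global solution (in $H^1_{\rm per}(\mathbb{T})$ for all $t\ge0$). The energy and the enstrophy of a function $u$ on $\mathbb{T}$ are $$K(u) = \frac12 \int_{\mathbb{T}} u^2\,dx, \qquad E(u) = \frac12 \int_{\mathbb{T}} u_x^2\,dx.$$ For real quantities, $A = \mathcal{O}(\mathcal{E}^p)$ as $\mathcal{E}\to\infty$ means that there are constants $0 \le C_- < C_+ < \infty$ with $C_-\mathcal{E}^p \le |A| \le C_+\mathcal{E}^p$ for all sufficiently large $\mathcal{E}$ (similarly for $\mathcal{O}(k^p)$ as $k\to\infty$); the bound is sharp if one can take $C_->0$. *)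

theory Defs
  imports "HOL-Analysis.Analysis" "HOL-Library.Periodic_Fun"
begin

text \<open>Functions on the circle are represented by their 1-periodic extensions to the real line
  (\<^const>\<open>periodic_fun_simple'\<close> is periodicity with period 1).\<close>

definition C3_per :: "(real \<Rightarrow> real) set" where
  "C3_per = {f. periodic_fun_simple' f
               \<and> (\<forall>j<3. \<forall>x. (deriv ^^ j) f differentiable (at x))
               \<and> continuous_on UNIV ((deriv ^^ 3) f)}"

definition energy :: "(real \<Rightarrow> real) \<Rightarrow> real" where
  "energy v = (1/2) * integral {-1/2..1/2} (\<lambda>x. (v x)\<^sup>2)"

definition enstrophy :: "(real \<Rightarrow> real) \<Rightarrow> real" where
  "enstrophy v = (1/2) * integral {-1/2..1/2} (\<lambda>x. (deriv v x)\<^sup>2)"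

text \<open>Global classical solutions \<open>u t x\<close> of the Cauchy problem: \<open>u\<close> is continuous up to \<open>t = 0\<close>,
  where it equals \<open>u0\<close>, and is of class \<open>C\<^sup>1\<close> in time and \<open>C\<^sup>2\<close> in space for \<open>t > 0\<close>, where it
  satisfies the equation. Values at negative times are irrelevant. For \<open>u0\<close> in \<^const>\<open>C3_per\<close>
  this determines \<open>u\<close> for \<open>t \<ge> 0\<close>, and parabolic smoothing makes solutions that are continuous in
  time with values in \<open>H\<^sup>1\<close> classical in this sense.\<close>

definition burgers_solution :: "(real \<Rightarrow> real) \<Rightarrow> (real \<Rightarrow> real \<Rightarrow> real) \<Rightarrow> bool" where
  "burgers_solution u0 u \<longleftrightarrow>
     (\<forall>t\<ge>0. periodic_fun_simple' (u t)) \<and>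
     continuous_on ({0..} \<times> UNIV) (\<lambda>(t, x). u t x) \<and>
     u 0 = u0 \<and>
     (\<exists>ut ux uxx.
        continuous_on ({0<..} \<times> UNIV) (\<lambda>(t, x). ut t x) \<and>
        continuous_on ({0<..} \<times> UNIV) (\<lambda>(t, x). ux t x) \<and>
        continuous_on ({0<..} \<times> UNIV) (\<lambda>(t, x). uxx t x) \<and>
        (\<forall>t>0. \<forall>x.
           ((\<lambda>s. u s x) has_real_derivative ut t x) (at t) \<and>
           (u t has_real_derivative ux t x) (at x) \<and>
           (ux t has_real_derivative uxx t x) (at x) \<and>
           ut t x + 2 * u t x * ux t x = uxx t x))"

end

theory Submission
  imports Defs
begin

text \<open>On \<open>[0, 1/2]\<close> the function \<open>- u\<close> is nonnegative and concave; concavity is propagated by a maximum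
  principle for second differences, which needs no more regularity than a classical solution has.
  The functions \<open>- a s + b tanh (b s)\<close> with \<open>a' = - 2 a\<^sup>2\<close> and \<open>b' = - 2 a b\<close> are exact solutions of the
  equation for \<open>- u\<close>: a line transported along characteristics with a viscous shock of half-height \<open>b\<close>
  at \<open>0\<close>. If such a function lies above \<open>- u\<close>, convexity of \<open>u\<close> and two integrations by parts bound the
  enstrophy by that of the barrier, which is \<open>(2/3) b\<^sup>3 + O(k\<^sup>2)\<close>. Using all tangent lines of \<open>- k f\<close>, the
  enstrophy is asymptotically at most that of the inviscid shock. On the other hand \<open>K' = - 2 E\<close>
  and essentially all of the initial energy is eventually lost, exactly as much as the inviscid
  shocks dissipate, so these upper bounds cannot be improved in the mean. Hence the enstrophy
  exceeds its values during the formation of the shock by a fixed factor, which places the maximum a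
  time of order \<open>1/k\<close> after the shock formation, when energy of order \<open>k\<^sup>2\<close> has been lost.\<close>

subsection \<open>Maximum principles and calculus\<close>

text \<open>A classical solution is only continuous at \<open>t = 0\<close>, so \<open>ux\<close>
  might be unbounded near the initial time, while every comparison of the solution with a reflected
  or shifted copy of itself produces a term \<open>- 2 * ux * Z\<close>. A lower bound on
  \<open>ux\<close> down to \<open>t = 0\<close> therefore precedes symmetry and concavity. The
  tangent line at \<open>x\<close> gives a sharp barrier at one moment only, when the inviscid
  characteristic from \<open>x\<close> reaches \<open>0\<close>: its transported intercept is then
  \<open>- k * f x\<close>. The coefficient \<open>2/3\<close> is the integral of
  \<open>sech^4\<close> over the half-line, and \<open>2 * (2/3) * h^3\<close> is the dissipation
  rate of an inviscid shock of half-height \<open>h\<close>, so the upper bounds for all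
  \<open>x\<close> integrate to exactly the inviscid loss. To exceed a level, the enstrophy is not
  bounded below directly: since the energy runs out, a deficit on one range of \<open>x\<close>
  would have to be made up elsewhere, where the upper bounds leave no room. Where the intercept
  vanishes, as for \<open>f\<close> linear near \<open>0\<close>, the line focuses to a point and
  the barrier blows up. This is why the onset of the shock is treated separately, with one fixed
  tangent line of small positive intercept.\<close>

lemma parabolic_maximum_principle:
  fixes Z :: "real \<Rightarrow> 'a::topological_space \<Rightarrow> real"
  assumes R: "compact R" and cont: "continuous_on ({0..T} \<times> R) (\<lambda>(t, r). Z t r)"
    and init: "\<And>r. r \<in> R \<Longrightarrow> Z 0 r \<le> 0"
    and deriv: "\<And>t r. 0 < t \<Longrightarrow> t \<le> T \<Longrightarrow> r \<in> R \<Longrightarrow> 0 < Z t r \<Longrightarrow> (\<And>r'. r' \<in> R \<Longrightarrow> Z t r' \<le> Z t r)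
        \<Longrightarrow> \<exists>D. ((\<lambda>s. Z s r) has_real_derivative D) (at t) \<and> D \<le> C * Z t r"
    and t: "0 \<le> t" "t \<le> T" and r: "r \<in> R"
  shows "Z t r \<le> 0"
proof (rule ccontr)
  assume neg: "\<not> Z t r \<le> 0"
  \<comment> \<open>The weight \<open>exp (- c * t)\<close> with \<open>c\<close> above
    \<open>C\<close> makes the time derivative at a positive maximum strictly negative, so slightly
    earlier values would be larger. Looking only backwards in time admits a maximum at
    \<open>T\<close> itself. The spatial second derivative test is left to each use, so
    \<open>R\<close> may be an interval or a rectangle of points and steps.\<close>
  define c where "c = C + 1"
  define Y where "Y = (\<lambda>(t, r). exp (- c * t) * Z t r)"
  have cY: "continuous_on ({0..T} \<times> R) Y"
    using cont unfolding Y_def case_prod_unfold by (intro continuous_intros) auto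
  have comp: "compact ({0..T} \<times> R)" using R by (intro compact_Times) auto
  obtain t1 r1 where m: "t1 \<in> {0..T}" "r1 \<in> R" and mx: "\<And>s q. s \<in> {0..T} \<Longrightarrow> q \<in> R \<Longrightarrow> Y (s, q) \<le> Y (t1, r1)"
    using continuous_attains_sup[OF comp _ cY] t r by fastforce
  have "0 < Y (t, r)" using neg by (simp add: Y_def)
  also have "\<dots> \<le> Y (t1, r1)" using mx t r by simp
  finally have pos: "0 < Z t1 r1" by (simp add: Y_def zero_less_mult_iff)
  have t1: "0 < t1" "t1 \<le> T" using m pos init[of r1] by (auto simp: less_eq_real_def)
  have "Z t1 q \<le> Z t1 r1" if "q \<in> R" for q using mx[OF m(1) that] by (simp add: Y_def)
  then obtain D where D: "((\<lambda>s. Z s r1) has_real_derivative D) (at t1)" "D \<le> C * Z t1 r1"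
    using deriv t1 m pos by blast
  have dY: "((\<lambda>s. exp (- c * s) * Z s r1) has_real_derivative exp (- c * t1) * (D - c * Z t1 r1)) (at t1)"
    by (rule derivative_eq_intros D refl | simp add: algebra_simps)+
  have "D - c * Z t1 r1 < 0" using D(2) pos by (simp add: c_def algebra_simps)
  then have "exp (- c * t1) * (D - c * Z t1 r1) < 0" by (simp add: mult_pos_neg)
  from DERIV_neg_dec_left[OF dY this]
  obtain d where d: "d > 0" "\<And>h. 0 < h \<Longrightarrow> h < d \<Longrightarrow> exp (- c * t1) * Z t1 r1 < exp (- c * (t1 - h)) * Z (t1 - h) r1"
    by auto
  define h where "h = min (d/2) (t1/2)"
  have "0 < h" "h < d" "t1 - h \<in> {0..T}" using d t1 by (auto simp: h_def min_def field_simps)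
  with d(2)[of h] mx[of "t1 - h" r1] m show False by (simp add: Y_def)
qed

lemma interior_max_deriv_zero:
  fixes F :: "real \<Rightarrow> real"
  assumes "\<And>x. (F has_real_derivative F1 x) (at x)" "a < x" "x < b" "\<And>y. a \<le> y \<Longrightarrow> y \<le> b \<Longrightarrow> F y \<le> F x"
  shows "F1 x = 0"
  by (rule DERIV_local_max[OF assms(1), of "min (x - a) (b - x)"]) (use assms in auto)

lemma interior_max_second_deriv_le:
  fixes F :: "real \<Rightarrow> real"
  assumes d: "\<And>x. (F has_real_derivative F1 x) (at x)" and d2: "\<And>x. (F1 has_real_derivative F2 x) (at x)"
    and x: "a < x" "x < b" and mx: "\<And>y. a \<le> y \<Longrightarrow> y \<le> b \<Longrightarrow> F y \<le> F x"
  shows "F2 x \<le> 0"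
proof (rule ccontr)
  assume "\<not> F2 x \<le> 0"
  then have "F2 x > 0" by simp
  from DERIV_pos_inc_right[OF d2 this] interior_max_deriv_zero[OF d x mx]
  obtain e where e: "e > 0" "\<And>h. 0 < h \<Longrightarrow> h < e \<Longrightarrow> 0 < F1 (x + h)" by auto
  define h where "h = min (e/2) ((b - x)/2)"
  have h: "0 < h" "h < e" "x + h < b" using e x by (auto simp: h_def min_def field_simps)
  have "F x < F (x + h)"
  proof (rule DERIV_pos_imp_increasing_open[of x "x + h"])
    show "x < x + h" using h by simp
    fix z assume "x < z" "z < x + h"
    then show "\<exists>y. (F has_real_derivative y) (at z) \<and> y > 0"
      using e(2)[of "z - x"] h d[of z] by auto
  next
    show "continuous_on {x..x + h} F" using d by (meson DERIV_continuous_on has_field_derivative_at_within)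
  qed
  with mx[of "x + h"] h x show False by simp
qed

lemma bounded_derivI:
  assumes "(F has_real_derivative D) (at t)" "D = a + b" "a \<le> 0" "b \<le> c"
  shows "\<exists>D. (F has_real_derivative D) (at t) \<and> D \<le> c"
  using assms by (intro exI[of _ D]) auto

lemma periodic_add_int:
  fixes h :: "real \<Rightarrow> 'a"
  assumes "\<And>x. h (x + 1) = h x"
  shows "h (x + of_int n) = h x"
proof -
  interpret periodic_fun_simple' h by standard (rule assms)
  show ?thesis by (rule plus_of_int)
qed

lemma periodic_frac:
  fixes h :: "real \<Rightarrow> 'a"
  assumes "\<And>x. h (x + 1) = h x"
  shows "h (frac x) = h x"
  using periodic_add_int[of h "frac x" "\<lfloor>x\<rfloor>"] assms by (simp add: frac_def)

text \<open>Follows from \<open>exp (2 * y) \<ge> 1 + 2 * y\<close>, because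
  \<open>(e - 1) / (e + 1)\<close> increases with \<open>e\<close>. It quantifies how close a shock
  layer is to saturation.\<close>

lemma tanh_ge: assumes "0 \<le> (y::real)" shows "y / (1 + y) \<le> tanh y"
proof -
  define e where "e = exp (2 * y)"
  have e: "1 + 2 * y \<le> e" using exp_ge_add_one_self[of "2 * y"] by (simp add: e_def)
  have "exp (- 2 * y) = inverse e" by (simp add: e_def exp_minus[symmetric])
  then have "tanh y = (1 - inverse e) / (1 + inverse e)"
    using tanh_real_altdef[of y] by simp
  also have "\<dots> = (e - 1) / (e + 1)" using e assms by (simp add: divide_simps)
  finally have *: "tanh y = (e - 1) / (e + 1)" .
  show ?thesis unfolding * using e assms by (simp add: field_simps)
qed

lemma has_integral_of_DERIV:
  fixes F :: "real \<Rightarrow> real"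
  assumes "\<And>x. (F has_real_derivative F' x) (at x)" "a \<le> b"
  shows "(F' has_integral F b - F a) {a..b}"
  using assms(2)
  by (rule fundamental_theorem_of_calculus)
    (auto simp: has_real_derivative_iff_has_vector_derivative[symmetric] intro: has_field_derivative_at_within assms(1))

lemma integral_even:
  fixes h :: "real \<Rightarrow> real"
  assumes "continuous_on UNIV h" "\<And>x. h (- x) = h x"
  shows "integral {-1/2..1/2} h = 2 * integral {0..1/2} h"
proof -
  have i: "h integrable_on {p..q}" for p q
    by (rule integrable_continuous_interval) (use assms(1) continuous_on_subset in blast)
  have "integral {-(1/2)..-0} (\<lambda>x. h (- x)) = integral {0..1/2} h" by (rule Henstock_Kurzweil_Integration.integral_reflect_real)
  moreover have "integral {-1/2..0} h + integral {0..1/2} h = integral {-1/2..1/2} h"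
    by (rule Henstock_Kurzweil_Integration.integral_combine) (use i in auto)
  ultimately show ?thesis using assms(2) by simp
qed

lemma enstrophy_nonneg: "0 \<le> enstrophy v"
  unfolding enstrophy_def
  \<comment> \<open>For arbitrary \<open>v\<close> the integrand may fail to be integrable; the
    integral is then \<open>0\<close> by default.\<close>
  by (cases "(\<lambda>x. (deriv v x)\<^sup>2) integrable_on {-1/2..1/2}") (auto intro!: integral_nonneg simp: not_integrable_integral)

subsection \<open>Gradient bounds for short times\<close>

locale burgers =
  fixes u ut ux uxx :: "real \<Rightarrow> real \<Rightarrow> real"
  assumes per: "\<And>t x. 0 \<le> t \<Longrightarrow> u t (x + 1) = u t x"
    and cont_u: "continuous_on ({0..} \<times> UNIV) (\<lambda>(t, x). u t x)"
    and cont_ut: "continuous_on ({0<..} \<times> UNIV) (\<lambda>(t, x). ut t x)"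
    and cont_ux: "continuous_on ({0<..} \<times> UNIV) (\<lambda>(t, x). ux t x)"
    and cont_uxx: "continuous_on ({0<..} \<times> UNIV) (\<lambda>(t, x). uxx t x)"
    and dt: "\<And>t x. 0 < t \<Longrightarrow> ((\<lambda>s. u s x) has_real_derivative ut t x) (at t)"
    and dx: "\<And>t x. 0 < t \<Longrightarrow> (u t has_real_derivative ux t x) (at x)"
    and dxx: "\<And>t x. 0 < t \<Longrightarrow> (ux t has_real_derivative uxx t x) (at x)"
    and eq: "\<And>t x. 0 < t \<Longrightarrow> ut t x = uxx t x - 2 * u t x * ux t x"
begin

lemma continuous_on_u [continuous_intros]:
  assumes "continuous_on S a" "continuous_on S b" "\<And>z. z \<in> S \<Longrightarrow> 0 \<le> a z"
  shows "continuous_on S (\<lambda>z. u (a z) (b z))"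
  using continuous_on_compose2[OF cont_u, of S "\<lambda>z. (a z, b z)"] assms
  by (auto intro!: continuous_intros)

lemma continuous_on_ux [continuous_intros]:
  assumes "continuous_on S a" "continuous_on S b" "\<And>z. z \<in> S \<Longrightarrow> 0 < a z"
  shows "continuous_on S (\<lambda>z. ux (a z) (b z))"
  using continuous_on_compose2[OF cont_ux, of S "\<lambda>z. (a z, b z)"] assms
  by (auto intro!: continuous_intros)

lemma continuous_on_uxx [continuous_intros]:
  assumes "continuous_on S a" "continuous_on S b" "\<And>z. z \<in> S \<Longrightarrow> 0 < a z"
  shows "continuous_on S (\<lambda>z. uxx (a z) (b z))"
  using continuous_on_compose2[OF cont_uxx, of S "\<lambda>z. (a z, b z)"] assms
  by (auto intro!: continuous_intros)

lemma continuous_on_ut [continuous_intros]: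
  assumes "continuous_on S a" "continuous_on S b" "\<And>z. z \<in> S \<Longrightarrow> 0 < a z"
  shows "continuous_on S (\<lambda>z. ut (a z) (b z))"
  using continuous_on_compose2[OF cont_ut, of S "\<lambda>z. (a z, b z)"] assms
  by (auto intro!: continuous_intros)

lemma dx' [derivative_intros]:
  assumes "(h has_real_derivative h') (at x)" "0 < t" "d = ux t (h x) * h'"
  shows "((\<lambda>x. u t (h x)) has_real_derivative d) (at x)"
  using DERIV_chain2[OF dx[OF assms(2)] assms(1)] assms(3) by simp

lemma dxx' [derivative_intros]:
  assumes "(h has_real_derivative h') (at x)" "0 < t" "d = uxx t (h x) * h'"
  shows "((\<lambda>x. ux t (h x)) has_real_derivative d) (at x)"
  using DERIV_chain2[OF dxx[OF assms(2)] assms(1)] assms(3) by simp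

lemma per_diff: "0 \<le> t \<Longrightarrow> u t (x - 1) = u t x"
  using per[of t "x - 1"] by simp

text \<open>The difference is compared with a linear modulus whose slope solves the Riccati
  equation of characteristics.\<close>

lemma two_point_bound_short_time:
  assumes A: "A > 0" and lip: "\<And>x y. x \<le> y \<Longrightarrow> u 0 x - u 0 y \<le> A * (y - x)"
    and t: "0 \<le> t" "t \<le> 1 / (4 * A)" and s: "0 \<le> s" "s \<le> 1/2"
  shows "u t (m - s) - u t (m + s) \<le> 4 * A * s"
proof -
  \<comment> \<open>Solution of \<open>a' = 2 * a^2\<close>, \<open>a 0 = A\<close>, which blows up
    at \<open>1 / (2 * A)\<close>. Stopping at half that time keeps
    \<open>a t \<le> 2 * A\<close>.\<close>
  define a where "a = (\<lambda>t. A / (1 - 2 * A * t))"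
  define Z where "Z = (\<lambda>t (m, s). u t (m - s) - u t (m + s) - 2 * a t * s)"
  define R where "R = {0..1::real} \<times> {0..1/2::real}"
  have den: "1/2 \<le> 1 - 2 * A * t" if "t \<le> 1 / (4 * A)" for t using that A by (simp add: field_simps)
  have abound: "0 < a t" "a t \<le> 2 * A" if "t \<le> 1 / (4 * A)" for t
    using den[OF that] A by (auto simp: a_def field_simps)
  have main: "Z t p \<le> 0" if "p \<in> R" for p
  proof (rule parabolic_maximum_principle[of R "1 / (4 * A)" Z "4 * A" t])
    show "compact R" unfolding R_def by (intro compact_Times) auto
    show "continuous_on ({0..1 / (4 * A)} \<times> R) (\<lambda>(t, r). Z t r)"
      unfolding Z_def a_def case_prod_unfold R_def
      by (intro continuous_intros) (auto dest!: den)
    show "Z 0 r \<le> 0" if "r \<in> R" for r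
      using lip[of "fst r - snd r" "fst r + snd r"] that
      by (auto simp: Z_def R_def a_def case_prod_unfold algebra_simps)
  next
    fix t r assume t: "0 < t" "t \<le> 1 / (4 * A)" and r: "r \<in> R" and pos: "0 < Z t r"
      and mx: "\<And>r'. r' \<in> R \<Longrightarrow> Z t r' \<le> Z t r"
    obtain m s where ms: "r = (m, s)" by force
    have m: "0 \<le> m" "m \<le> 1" and s: "0 \<le> s" "s \<le> 1/2" using r by (auto simp: R_def ms)
    have "s \<noteq> 0" using pos by (auto simp: Z_def ms)
    \<comment> \<open>At \<open>s = 1/2\<close> the two points coincide on the circle, so
      \<open>Z\<close> cannot be positive there.\<close>
    moreover have "s \<noteq> 1/2" 
    proof
      assume "s = 1/2"
      then have ms1: "m - s + 1 = m + s" by simp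
      have "u t (m - s) = u t (m + s)" using per[of t "m - s"] t unfolding ms1 by simp
      then show False using pos abound[OF t(2)] s by (simp add: Z_def ms mult_less_0_iff)
    qed
    ultimately have s': "0 < s" "s < 1/2" using s by auto
    have Zper: "Z t (y + 1, s') = Z t (y, s')" for y s'
      using per[of t "y - s'"] per[of t "y + s'"] t by (simp add: Z_def algebra_simps)
    \<comment> \<open>Periodicity in the midpoint extends maximality beyond \<open>{0..1}\<close>,
      so a maximum with \<open>m = 0\<close> or \<open>m = 1\<close> also counts as
      interior.\<close>
    have mx1: "Z t (y, s) \<le> Z t (m, s)" if "m - 1 \<le> y" "y \<le> m + 1" for y
    proof -
      have "y < 0 \<or> 0 \<le> y \<and> y \<le> 1 \<or> 1 < y" by auto
      then show ?thesis
        using mx[of "(y, s)"] mx[of "(y + 1, s)"] mx[of "(y - 1, s)"] Zper[of y s] Zper[of "y - 1" s] s m that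
        by (auto simp: R_def ms)
    qed
    have 1: "ux t (m - s) - ux t (m + s) = 0"
      by (rule interior_max_deriv_zero[of "\<lambda>y. Z t (y, s)" "\<lambda>y. ux t (y - s) - ux t (y + s)" "m - 1" m "m + 1"])
        (use mx1 t in \<open>auto simp: Z_def intro!: derivative_eq_intros\<close>)
    have mx2: "Z t (m, y) \<le> Z t (m, s)" if "0 \<le> y" "y \<le> 1/2" for y
      using mx[of "(m, y)"] m that by (auto simp: R_def ms)
    have 2: "- ux t (m - s) - ux t (m + s) - 2 * a t = 0"
      by (rule interior_max_deriv_zero[of "\<lambda>y. Z t (m, y)" "\<lambda>y. - ux t (m - y) - ux t (m + y) - 2 * a t" 0 s "1/2"])
        (use mx2 t s' in \<open>auto simp: Z_def intro!: derivative_eq_intros\<close>)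
    have 3: "uxx t (m - s) - uxx t (m + s) \<le> 0"
      by (rule interior_max_second_deriv_le[of "\<lambda>y. Z t (m, y)" "\<lambda>y. - ux t (m - y) - ux t (m + y) - 2 * a t"
            "\<lambda>y. uxx t (m - y) - uxx t (m + y)" 0 s "1/2"])
        (use mx2 t s' in \<open>auto simp: Z_def intro!: derivative_eq_intros\<close>)
    have da: "(a has_real_derivative 2 * (a t)^2) (at t)"
      using den[OF t(2)] unfolding a_def
      by (auto intro!: derivative_eq_intros simp: field_simps power2_eq_square)
    have p: "ux t (m - s) = - a t" "ux t (m + s) = - a t" using 1 2 by auto
    \<comment> \<open>With both slopes equal to \<open>- a t\<close>, the nonlinear terms give
      \<open>2 * a t * (Z + 2 * a t * s)\<close>; the Riccati term removes the part without
      \<open>Z\<close>.\<close>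
    have "((\<lambda>t. Z t r) has_real_derivative ut t (m - s) - ut t (m + s) - 4 * (a t)^2 * s) (at t)"
      unfolding Z_def ms prod.case using t by (auto intro!: derivative_eq_intros dt da)
    moreover have "ut t (m - s) - ut t (m + s) - 4 * (a t)^2 * s \<le> 2 * a t * Z t r"
      using 3 by (simp add: eq[OF t(1)] p Z_def ms algebra_simps power2_eq_square)
    moreover have "2 * a t * Z t r \<le> 4 * A * Z t r" using abound[OF t(2)] pos by (intro mult_right_mono) auto
    ultimately show "\<exists>D. ((\<lambda>t. Z t r) has_real_derivative D) (at t) \<and> D \<le> 4 * A * Z t r" by force
  qed (use t that in auto)
  have *: "u t (m - s) - u t (m + s) \<le> 4 * A * s" if "0 \<le> m" "m \<le> 1" for m
  proof -
    have "Z t (m, s) \<le> 0" using main[of "(m, s)"] that s by (simp add: R_def)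
    moreover have "a t * s \<le> 2 * A * s" using abound[OF t(2)] s by (intro mult_right_mono) auto
    ultimately show ?thesis by (simp add: Z_def)
  qed
  have "u t (frac m - s) - u t (frac m + s) \<le> 4 * A * s"
    by (rule *) (auto simp: frac_ge_0 less_imp_le[OF frac_lt_1])
  moreover have "u t (frac m - s) = u t (m - s)" "u t (frac m + s) = u t (m + s)"
    using periodic_add_int[of "u t" "frac m - s" "\<lfloor>m\<rfloor>"] periodic_add_int[of "u t" "frac m + s" "\<lfloor>m\<rfloor>"] per t
    by (auto simp: frac_def algebra_simps)
  ultimately show ?thesis by simp
qed

text \<open>For short times the two-point bound with vanishing step gives
  \<open>ux \<ge> - 2 * A\<close>; from \<open>t0\<close> on, \<open>ux\<close> is continuous on a
  compact rectangle. Only the existence of \<open>C\<close> matters: it enters the maximum principle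
  as the rate constant and disappears from its conclusion.\<close>

lemma ux_lower_bound:
  assumes A: "A > 0" and lip: "\<And>x y. x \<le> y \<Longrightarrow> u 0 x - u 0 y \<le> A * (y - x)"
  obtains C where "\<And>t x. 0 < t \<Longrightarrow> t \<le> T \<Longrightarrow> -1 \<le> x \<Longrightarrow> x \<le> 2 \<Longrightarrow> - C \<le> ux t x" "C \<ge> 0"
proof -
  define t0 where "t0 = 1 / (4 * A)"
  have t0: "t0 > 0" using A by (simp add: t0_def)
  have early: "- 2 * A \<le> ux t x" if t: "0 < t" "t \<le> t0" for t x
  proof (rule ccontr)
    assume "\<not> - 2 * A \<le> ux t x"
    then have neg: "2 * ux t x + 4 * A < 0" by simp
    have d: "((\<lambda>s. u t (x + s) - u t (x - s) + 4 * A * s) has_real_derivative (2 * ux t x + 4 * A)) (at 0)"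
      using t by (auto intro!: derivative_eq_intros)
    obtain e where e: "e > 0" "\<And>h. 0 < h \<Longrightarrow> h < e \<Longrightarrow> u t (x + h) - u t (x - h) + 4 * A * h < 0"
      using DERIV_neg_dec_right[OF d neg] by auto
    define h where "h = min (e/2) (1/2)"
    have "0 < h" "h < e" "h \<le> 1/2" using e by (auto simp: h_def)
    with e(2)[of h] two_point_bound_short_time[OF A lip, of t h x] t show False by (simp add: t0_def)
  qed
  have "compact ((\<lambda>(t, x). ux t x) ` ({t0..T} \<times> {-1..2}))"
    by (intro compact_continuous_image compact_Times) (use t0 in \<open>auto simp: case_prod_unfold intro!: continuous_intros\<close>)
  then obtain B where B: "\<And>t x. t0 \<le> t \<Longrightarrow> t \<le> T \<Longrightarrow> -1 \<le> x \<Longrightarrow> x \<le> 2 \<Longrightarrow> \<bar>ux t x\<bar> \<le> B"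
    by (fastforce dest!: compact_imp_bounded simp: bounded_iff)
  show thesis
  proof (rule that[of "max (2 * A) B"])
    fix t x :: real assume "0 < t" "t \<le> T" "-1 \<le> x" "x \<le> 2"
    then show "- max (2 * A) B \<le> ux t x"
      using early[of t x] B[of t x] by (cases "t \<le> t0") auto
  qed (use A in auto)
qed

end

subsection \<open>Odd solutions with convex profile\<close>

locale odd_convex_profile =
  fixes f f1 f2 :: "real \<Rightarrow> real"
  assumes f_per: "\<And>x. f (x + 1) = f x"
    and f_odd: "\<And>x. f (- x) = - f x"
    and df: "\<And>x. (f has_real_derivative f1 x) (at x)"
    and df1: "\<And>x. (f1 has_real_derivative f2 x) (at x)"
    and f2_nonneg: "\<And>x. 0 \<le> x \<Longrightarrow> x \<le> 1/2 \<Longrightarrow> 0 \<le> f2 x"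
    and f2_cont: "continuous_on UNIV f2"
    and f_nonzero: "\<exists>x. f x \<noteq> 0"
begin

section \<open>Geometry of the initial profile\<close>

lemma df' [derivative_intros]:
  assumes "(h has_real_derivative h') (at x)" "d = f1 (h x) * h'"
  shows "((\<lambda>x. f (h x)) has_real_derivative d) (at x)"
  using DERIV_chain2[OF df assms(1)] assms(2) by simp

lemma df1' [derivative_intros]:
  assumes "(h has_real_derivative h') (at x)" "d = f2 (h x) * h'"
  shows "((\<lambda>x. f1 (h x)) has_real_derivative d) (at x)"
  using DERIV_chain2[OF df1 assms(1)] assms(2) by simp

lemma continuous_on_f [continuous_intros]: "continuous_on S h \<Longrightarrow> continuous_on S (\<lambda>x. f (h x))"
  using continuous_on_compose2[of UNIV f S h] DERIV_continuous_on[of UNIV f f1] df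
  by (auto intro: has_field_derivative_at_within)

lemma continuous_on_f1 [continuous_intros]: "continuous_on S h \<Longrightarrow> continuous_on S (\<lambda>x. f1 (h x))"
  using continuous_on_compose2[of UNIV f1 S h] DERIV_continuous_on[of UNIV f1 f2] df1
  by (auto intro: has_field_derivative_at_within)

lemma continuous_on_f2 [continuous_intros]: "continuous_on S h \<Longrightarrow> continuous_on S (\<lambda>x. f2 (h x))"
  using continuous_on_compose2[OF f2_cont, of S h] by auto

lemma f_0: "f 0 = 0" using f_odd[of 0] by simp

lemma f_reflect: "f (1 - x) = - f x"
  using f_per[of "- x"] f_odd[of x] by (simp add: algebra_simps)

lemma f_half: "f (1/2) = 0" using f_reflect[of "1/2"] by simp

lemma f1_even: "f1 (- x) = f1 x"
proof -
  have "((\<lambda>x. - f (- x)) has_real_derivative f1 (- x)) (at x)" by (auto intro!: derivative_eq_intros)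
  then have "(f has_real_derivative f1 (- x)) (at x)" by (simp add: f_odd)
  then show ?thesis using DERIV_unique[OF _ df] by blast
qed

lemma f1_reflect: "f1 (1 - x) = f1 x"
proof -
  have "((\<lambda>x. - f (1 - x)) has_real_derivative f1 (1 - x)) (at x)" by (auto intro!: derivative_eq_intros)
  then have "(f has_real_derivative f1 (1 - x)) (at x)" by (simp add: f_reflect)
  then show ?thesis using DERIV_unique[OF _ df] by blast
qed

lemma f1_per: "f1 (x + 1) = f1 x"
  using f1_reflect[of "- x"] f1_even[of x] by (simp add: add.commute)

lemma f1_mono: "0 \<le> x \<Longrightarrow> x \<le> y \<Longrightarrow> y \<le> 1/2 \<Longrightarrow> f1 x \<le> f1 y"
  by (rule DERIV_nonneg_imp_nondecreasing) (use df1 f2_nonneg in force)+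

lemma f_tangent:
  assumes "0 \<le> x" "x \<le> 1/2" "0 \<le> s" "s \<le> 1/2"
  shows "f x + f1 x * (s - x) \<le> f s"
proof (cases s x rule: linorder_cases)
  case less
  then obtain z where "s < z" "z < x" "f x - f s = (x - s) * f1 z" using MVT2[of s x f f1] df by blast
  moreover from this have "(x - s) * f1 z \<le> (x - s) * f1 x"
    using f1_mono[of z x] assms less by (intro mult_left_mono) auto
  ultimately show ?thesis by (simp add: algebra_simps)
next
  case greater
  then obtain z where "x < z" "z < s" "f s - f x = (s - x) * f1 z" using MVT2[of x s f f1] df by blast
  moreover from this have "(s - x) * f1 x \<le> (s - x) * f1 z"
    using f1_mono[of x z] assms greater by (intro mult_left_mono) auto
  ultimately show ?thesis by (simp add: algebra_simps)
qed simp

lemma f_nonpos: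
  assumes "0 \<le> x" "x \<le> 1/2"
  shows "f x \<le> 0"
proof (rule ccontr)
  assume *: "\<not> f x \<le> 0"
  have "f1 x * (0 - x) \<le> - f x" using f_tangent[of x 0] assms f_0 by simp
  moreover have "f1 x * (1/2 - x) \<le> - f x" using f_tangent[of x "1/2"] assms f_half by simp
  moreover have "0 \<le> f1 x * (0 - x) \<or> 0 \<le> f1 x * (1/2 - x)"
    using assms by (cases "0 \<le> f1 x") (auto simp: mult_nonpos_nonneg)
  ultimately show False using * by linarith
qed

text \<open>A zero in the open interval would be a maximum with horizontal tangent; convexity then
  forces \<open>f\<close> to vanish on the half period, and symmetry spreads this to the whole
  line.\<close>

lemma f_neg:
  assumes "0 < x" "x < 1/2"
  shows "f x < 0"
proof (rule ccontr)
  assume "\<not> f x < 0"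
  then have fx: "f x = 0" using f_nonpos[of x] assms by simp
  have "f1 x = 0" by (rule interior_max_deriv_zero[OF df, of 0 x "1/2"]) (use assms fx f_nonpos in auto)
  then have z: "f s = 0" if "0 \<le> s" "s \<le> 1/2" for s
    using f_tangent[of x s] f_nonpos[of s] assms fx that by simp
  have "f y = 0" for y
  proof (cases "frac y \<le> 1/2")
    case True then show ?thesis using z[of "frac y"] periodic_frac[of f y] f_per by auto
  next
    case False then show ?thesis
      using z[of "1 - frac y"] periodic_frac[of f y] f_per frac_lt_1[of y] f_reflect[of "frac y"] by auto
  qed
  then show False using f_nonzero by blast
qed

lemma f1_0_neg: "f1 0 < 0"
  using f_tangent[of 0 "1/4"] f_neg[of "1/4"] f_0 by (simp add: algebra_simps)

text \<open>The supremum of \<open>\<bar>f1\<bar>\<close>: the slope increases on the half period,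
  so its extremes are at the ends, and reflection covers the rest.\<close>

definition L :: real where "L = max (- f1 0) (f1 (1/2))"

lemma L_pos: "L > 0" using f1_0_neg by (simp add: L_def)

lemma f1_bound: "\<bar>f1 x\<bar> \<le> L"
proof -
  have *: "\<bar>f1 x\<bar> \<le> L" if "0 \<le> x" "x \<le> 1/2" for x
    using f1_mono[of 0 x] f1_mono[of x "1/2"] that by (auto simp: L_def)
  show ?thesis
    using *[of "frac x"] *[of "1 - frac x"] periodic_frac[of f1 x] f1_per frac_lt_1[of x] f1_reflect[of "frac x"]
    by (cases "frac x \<le> 1/2") auto
qed

lemma f_lipschitz: "x \<le> y \<Longrightarrow> \<bar>f x - f y\<bar> \<le> L * (y - x)"
proof (cases "x = y")
  case False
  assume "x \<le> y"
  with False obtain z where "f y - f x = (y - x) * f1 z" using MVT2[of x y f f1] df by force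
  then have "\<bar>f x - f y\<bar> = \<bar>f1 z\<bar> * (y - x)"
    using \<open>x \<le> y\<close> by (subst abs_minus_commute) (simp add: abs_mult)
  also have "\<dots> \<le> L * (y - x)" using f1_bound \<open>x \<le> y\<close> by (intro mult_right_mono) auto
  finally show ?thesis .
qed simp

lemma f_le_linear: assumes "0 \<le> x" "x \<le> 1/2" shows "- f x \<le> L * x"
proof -
  have "- f x \<le> - f1 0 * x" using f_tangent[of 0 x] f_0 assms by simp
  also have "\<dots> \<le> L * x" using assms by (intro mult_right_mono) (auto simp: L_def)
  finally show ?thesis .
qed

text \<open>The points \<open>x + h\<close> and \<open>x - h\<close> may leave
  \<open>{0..1/2}\<close> for the region where \<open>f\<close> is concave. Reflection at
  \<open>0\<close> and at \<open>1/2\<close> brings the slopes back to the half period, where they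
  stay in the right order.\<close>

lemma f_second_difference:
  assumes "0 \<le> x" "x \<le> 1/2" "0 \<le> h" "h \<le> 1/2"
  shows "2 * f x \<le> f (x + h) + f (x - h)"
proof -
  have "f (x + 0) + f (x - 0) \<le> f (x + h) + f (x - h)"
  proof (rule DERIV_nonneg_imp_nondecreasing[of 0 h "\<lambda>h. f (x + h) + f (x - h)"])
    fix y assume y: "0 \<le> y" "y \<le> h"
    have 1: "f1 (x - y) = f1 \<bar>x - y\<bar>" using f1_even[of "x - y"] by (auto simp: abs_if)
    have "f1 (x - y) \<le> f1 (x + y)"
    proof (cases "x + y \<le> 1/2")
      case True then show ?thesis unfolding 1 using y assms by (intro f1_mono) auto
    next
      case False
      have "f1 \<bar>x - y\<bar> \<le> f1 (1 - (x + y))" using y assms False by (intro f1_mono) auto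
      then show ?thesis using 1 f1_reflect by simp
    qed
    then show "\<exists>d. ((\<lambda>h. f (x + h) + f (x - h)) has_real_derivative d) (at y) \<and> 0 \<le> d"
      by (intro exI[of _ "f1 (x + y) - f1 (x - y)"]) (auto intro!: derivative_eq_intros)
  qed (use assms in auto)
  then show ?thesis by simp
qed

end

locale odd_convex_burgers = odd_convex_profile f f1 f2 + burgers u ut ux uxx
  for f f1 f2 :: "real \<Rightarrow> real" and u ut ux uxx :: "real \<Rightarrow> real \<Rightarrow> real" +
  fixes k :: real
  assumes k_pos: "0 < k" and init: "\<And>x. u 0 x = k * f x"
begin

section \<open>Symmetry, sign and convexity of the solution\<close>

lemma ux_lower: obtains C where "C \<ge> 0" "\<And>t x. 0 < t \<Longrightarrow> t \<le> T \<Longrightarrow> -1 \<le> x \<Longrightarrow> x \<le> 2 \<Longrightarrow> - C \<le> ux t x"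
proof (rule ux_lower_bound[of "k * L" T])
  fix x y :: real assume "x \<le> y"
  from mult_left_mono[OF order_trans[OF abs_ge_self f_lipschitz[OF this]], of k] k_pos
  show "u 0 x - u 0 y \<le> k * L * (y - x)" by (simp add: init algebra_simps)
qed (use k_pos L_pos that in auto)

text \<open>An instance of uniqueness, since \<open>- u t (- x)\<close> solves the same problem. At
  an extremum of \<open>u t x + u t (- x)\<close> the slopes at \<open>x\<close> and
  \<open>- x\<close> agree, so the nonlinear terms combine to a multiple of this sum. The sign
  \<open>\<sigma>\<close> yields both inequalities.\<close>

lemma u_odd: assumes "0 \<le> t" shows "u t (- x) = - u t x"
proof -
  obtain C where C: "C \<ge> 0" "\<And>s x. 0 < s \<Longrightarrow> s \<le> t \<Longrightarrow> -1 \<le> x \<Longrightarrow> x \<le> 2 \<Longrightarrow> - C \<le> ux s x"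
    using ux_lower[of t] by blast
  have *: "\<sigma> * (u t x + u t (- x)) \<le> 0" if "\<bar>\<sigma>\<bar> = 1" "0 \<le> x" "x \<le> 1" for \<sigma> x
  proof (rule parabolic_maximum_principle[of "{0..1::real}" t "\<lambda>t x. \<sigma> * (u t x + u t (- x))" "2 * C" t x])
    show "continuous_on ({0..t} \<times> {0..1}) (\<lambda>(t, x). \<sigma> * (u t x + u t (- x)))"
      unfolding case_prod_unfold by (intro continuous_intros) auto
  next
    fix s x assume s: "0 < s" "s \<le> t" and x: "x \<in> {0..1::real}"
      and pos: "0 < \<sigma> * (u s x + u s (- x))"
      and mx: "\<And>r'. r' \<in> {0..1} \<Longrightarrow> \<sigma> * (u s r' + u s (- r')) \<le> \<sigma> * (u s x + u s (- x))"
    let ?Z = "\<lambda>x. \<sigma> * (u s x + u s (- x))"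
    have Zper: "?Z (y + 1) = ?Z y" for y
    proof -
      have "u s (- (y + 1)) = u s (- y)" using per_diff[of s "- y"] s by (simp only: minus_add_distrib diff_conv_add_uminus)
      moreover have "u s (y + 1) = u s y" using per[of s y] s by simp
      ultimately show ?thesis by (simp only:)
    qed
    have mx1: "?Z y \<le> ?Z x" for y
      using mx[of "frac y"] periodic_frac[of ?Z y] Zper frac_ge_0[of y] frac_lt_1[of y] by auto
    have "\<sigma> * (ux s x - ux s (- x)) = 0"
      by (rule interior_max_deriv_zero[of ?Z "\<lambda>x. \<sigma> * (ux s x - ux s (- x))" "x - 1" x "x + 1"])
        (use mx1 s in \<open>auto intro!: derivative_eq_intros simp: algebra_simps\<close>)
    then have p: "ux s (- x) = ux s x" using that by auto
    have D2: "\<sigma> * (uxx s x + uxx s (- x)) \<le> 0"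
      by (rule interior_max_second_deriv_le[of ?Z "\<lambda>x. \<sigma> * (ux s x - ux s (- x))" "\<lambda>x. \<sigma> * (uxx s x + uxx s (- x))" "x - 1" x "x + 1"])
        (use mx1 s in \<open>auto intro!: derivative_eq_intros simp: algebra_simps\<close>)
    have "((\<lambda>s. \<sigma> * (u s x + u s (- x))) has_real_derivative \<sigma> * (ut s x + ut s (- x))) (at s)"
      using s by (auto intro!: derivative_eq_intros dt)
    moreover have "\<sigma> * (ut s x + ut s (- x)) = \<sigma> * (uxx s x + uxx s (- x)) + (- 2 * ux s x) * ?Z x"
      using s by (simp add: eq p algebra_simps)
    moreover have "(- 2 * ux s x) * ?Z x \<le> 2 * C * ?Z x"
      using C(2)[of s x] s x pos by (intro mult_right_mono) auto
    ultimately show "\<exists>D. ((\<lambda>s. \<sigma> * (u s x + u s (- x))) has_real_derivative D) (at s) \<and> D \<le> 2 * C * ?Z x"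
      by (rule bounded_derivI[OF _ _ D2])
  qed (use that assms in \<open>auto simp: init f_odd\<close>)
  have **: "u t (- x) = - u t x" if "0 \<le> x" "x \<le> 1" for x using *[of 1 x] *[of "-1" x] that by auto
  have "u t (- x) = u t (- frac x)"
    using periodic_add_int[of "u t" "- x" "\<lfloor>x\<rfloor>"] per assms by (simp add: frac_def)
  then show ?thesis
    using **[of "frac x"] frac_ge_0[of x] frac_lt_1[of x] periodic_frac[of "u t" x] per assms by auto
qed

lemma u_0: "0 \<le> t \<Longrightarrow> u t 0 = 0" using u_odd[of t 0] by simp

lemma u_reflect: "0 \<le> t \<Longrightarrow> u t (1 - x) = - u t x"
  using per[of t "- x"] u_odd[of t x] by (simp add: add.commute)

lemma u_half: "0 \<le> t \<Longrightarrow> u t (1/2) = 0" using u_reflect[of t "1/2"] by simp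

lemma ux_even: assumes "0 < t" shows "ux t (- x) = ux t x"
proof -
  have "((\<lambda>x. - u t (- x)) has_real_derivative ux t (- x)) (at x)"
    using assms by (auto intro!: derivative_eq_intros)
  then have "(u t has_real_derivative ux t (- x)) (at x)" using assms by (simp add: u_odd)
  then show ?thesis using DERIV_unique[OF _ dx[OF assms]] by blast
qed

lemma u_nonpos: assumes "0 \<le> t" "0 \<le> x" "x \<le> 1/2" shows "u t x \<le> 0"
proof (rule parabolic_maximum_principle[of "{0..1/2::real}" t u 0 t x])
  show "continuous_on ({0..t} \<times> {0..1/2}) (\<lambda>(t, x). u t x)"
    unfolding case_prod_unfold by (intro continuous_intros) auto
next
  fix s x assume s: "0 < s" "s \<le> t" and x: "x \<in> {0..1/2::real}" and pos: "0 < u s x"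
    and mx: "\<And>r'. r' \<in> {0..1/2} \<Longrightarrow> u s r' \<le> u s x"
  have "u s x \<noteq> u s 0" "u s x \<noteq> u s (1/2)" using pos u_0[of s] u_half[of s] s by auto
    then have "x \<noteq> 0" "x \<noteq> 1/2" by metis+
  then have x': "0 < x" "x < 1/2" using x by auto
  have "ux s x = 0"
    by (rule interior_max_deriv_zero[OF dx[OF s(1)] x']) (use mx in auto)
  moreover have "uxx s x \<le> 0"
    by (rule interior_max_second_deriv_le[OF dx[OF s(1)] dxx[OF s(1)] x']) (use mx in auto)
  ultimately show "\<exists>D. ((\<lambda>s. u s x) has_real_derivative D) (at s) \<and> D \<le> 0 * u s x"
    using dt[OF s(1), of x] eq[OF s(1), of x] by auto
qed (use assms in \<open>auto simp: init intro!: mult_nonneg_nonpos less_imp_le[OF k_pos] f_nonpos\<close>)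

text \<open>At a negative minimum of the second difference in both the midpoint and the step, the three
  slopes involved coincide, so the nonlinear terms combine to a multiple of the second difference.\<close>

lemma u_second_difference:
  assumes "0 \<le> t" "0 \<le> x" "x \<le> 1/2" "0 \<le> h" "h \<le> 1/2"
  shows "2 * u t x - u t (x + h) - u t (x - h) \<le> 0"
proof -
  obtain C where C: "C \<ge> 0" "\<And>s x. 0 < s \<Longrightarrow> s \<le> t \<Longrightarrow> -1 \<le> x \<Longrightarrow> x \<le> 2 \<Longrightarrow> - C \<le> ux s x"
    using ux_lower[of t] by blast
  define Z where "Z = (\<lambda>t (x, h). 2 * u t x - u t (x + h) - u t (x - h))"
  define R where "R = {0..1/2::real} \<times> {0..1/2::real}"
  have "Z t (x, h) \<le> 0"
  proof (rule parabolic_maximum_principle[of R t Z "2 * C"])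
    show "compact R" unfolding R_def by (intro compact_Times) auto
    show "continuous_on ({0..t} \<times> R) (\<lambda>(t, r). Z t r)"
      unfolding Z_def case_prod_unfold R_def by (intro continuous_intros) auto
    show "Z 0 r \<le> 0" if "r \<in> R" for r
      using mult_left_mono[OF f_second_difference[of "fst r" "snd r"], of k] that k_pos
      by (auto simp: Z_def R_def init case_prod_unfold algebra_simps)
  next
    fix s r assume s: "0 < s" "s \<le> t" and r: "r \<in> R" and pos: "0 < Z s r"
      and mx: "\<And>r'. r' \<in> R \<Longrightarrow> Z s r' \<le> Z s r"
    obtain x h where xh: "r = (x, h)" by force
    have x: "0 \<le> x" "x \<le> 1/2" and h: "0 \<le> h" "h \<le> 1/2" using r by (auto simp: R_def xh)
    have "x \<noteq> 0" using pos u_0[of s] u_odd[of s h] s by (auto simp: Z_def xh)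
    moreover have "Z s (x, h) \<noteq> Z s (1/2, h)"
      using pos u_half[of s] u_reflect[of s "1/2 + h"] s by (auto simp: Z_def xh)
    then have "x \<noteq> 1/2" by metis
    moreover have "h \<noteq> 0" using pos by (auto simp: Z_def xh)
    moreover have "h \<noteq> 1/2"
    \<comment> \<open>The neighbours \<open>x + 1/2\<close> and \<open>x - 1/2\<close> are one point
      of the circle, where the value is \<open>- u s (1/2 - x) \<ge> 0\<close>; hence the sign of
      \<open>u\<close> has to be known before its convexity.\<close>
    proof
      assume h: "h = 1/2"
      have "u s (x - 1/2) = - u s (1/2 - x)" using u_odd[of s "1/2 - x"] s by simp
      moreover have "u s (x + 1/2) = - u s (1/2 - x)" using u_reflect[of s "1/2 - x"] s by (simp add: add.commute)
      moreover have "u s x \<le> 0" "u s (1/2 - x) \<le> 0" using u_nonpos s x by auto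
      ultimately show False using pos by (simp add: Z_def xh h)
    qed
    ultimately have x': "0 < x" "x < 1/2" and h': "0 < h" "h < 1/2" using x h by auto
    have mx1: "Z s (y, h) \<le> Z s (x, h)" if "0 \<le> y" "y \<le> 1/2" for y
      using mx[of "(y, h)"] h that by (auto simp: R_def xh)
    have mx2: "Z s (x, y) \<le> Z s (x, h)" if "0 \<le> y" "y \<le> 1/2" for y
      using mx[of "(x, y)"] x that by (auto simp: R_def xh)
    have 1: "2 * ux s x - ux s (x + h) - ux s (x - h) = 0"
      by (rule interior_max_deriv_zero[of "\<lambda>y. Z s (y, h)" "\<lambda>y. 2 * ux s y - ux s (y + h) - ux s (y - h)" 0 x "1/2"])
        (use mx1 s x' in \<open>auto simp: Z_def intro!: derivative_eq_intros\<close>)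
    have 2: "- ux s (x + h) + ux s (x - h) = 0"
      by (rule interior_max_deriv_zero[of "\<lambda>y. Z s (x, y)" "\<lambda>y. - ux s (x + y) + ux s (x - y)" 0 h "1/2"])
        (use mx2 s h' in \<open>auto simp: Z_def intro!: derivative_eq_intros\<close>)
    have p: "ux s (x + h) = ux s x" "ux s (x - h) = ux s x" using 1 2 by auto
    have 3: "2 * uxx s x - uxx s (x + h) - uxx s (x - h) \<le> 0"
      by (rule interior_max_second_deriv_le[of "\<lambda>y. Z s (y, h)" "\<lambda>y. 2 * ux s y - ux s (y + h) - ux s (y - h)"
            "\<lambda>y. 2 * uxx s y - uxx s (y + h) - uxx s (y - h)" 0 x "1/2"])
        (use mx1 s x' in \<open>auto simp: Z_def intro!: derivative_eq_intros\<close>)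
    have "((\<lambda>s. Z s r) has_real_derivative 2 * ut s x - ut s (x + h) - ut s (x - h)) (at s)"
      unfolding Z_def xh prod.case using s by (auto intro!: derivative_eq_intros dt)
    moreover have "2 * ut s x - ut s (x + h) - ut s (x - h)
        = (2 * uxx s x - uxx s (x + h) - uxx s (x - h)) + (- 2 * ux s x) * Z s r"
      unfolding eq[OF s(1)] p Z_def xh prod.case by algebra
    moreover have "(- 2 * ux s x) * Z s r \<le> 2 * C * Z s r"
      using C(2)[of s x] s x pos by (intro mult_right_mono) auto
    ultimately show "\<exists>D. ((\<lambda>s. Z s r) has_real_derivative D) (at s) \<and> D \<le> 2 * C * Z s r"
      by (rule bounded_derivI[OF _ _ 3])
  qed (use assms in \<open>auto simp: R_def\<close>)
  then show ?thesis by (simp add: Z_def)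
qed

text \<open>As a function of the step, the second difference has its maximum \<open>0\<close> at
  step \<open>0\<close>, and its second derivative there is \<open>- 2 * uxx t x\<close>.\<close>

lemma uxx_nonneg: assumes t: "0 < t" and "0 \<le> x" "x \<le> 1/2" shows "0 \<le> uxx t x"
proof -
  have "- (uxx t (x + 0) + uxx t (x - 0)) \<le> 0"
  proof (rule interior_max_second_deriv_le[of "\<lambda>h. 2 * u t x - u t (x + h) - u t (x - h)"
        "\<lambda>h. - ux t (x + h) + ux t (x - h)" "\<lambda>h. - (uxx t (x + h) + uxx t (x - h))" "-1/2" 0 "1/2"])
    fix y :: real assume "- 1 / 2 \<le> y" "y \<le> 1 / 2"
    then show "2 * u t x - u t (x + y) - u t (x - y) \<le> 2 * u t x - u t (x + 0) - u t (x - 0)"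
      using u_second_difference[of t x "\<bar>y\<bar>"] assms by (cases "0 \<le> y") auto
  qed (use t in \<open>auto intro!: derivative_eq_intros\<close>)
  then show ?thesis by simp
qed

lemma ux_mono: assumes "0 < t" "0 \<le> x" "x \<le> y" "y \<le> 1/2" shows "ux t x \<le> ux t y"
  by (rule DERIV_nonneg_imp_nondecreasing) (use assms dxx[OF assms(1)] uxx_nonneg[OF assms(1)] in force)+

text \<open>The function \<open>w = - u\<close> satisfies \<open>w_t = w_xx + 2 w w_x\<close>, and
  \<open>\<psi>\<close> is a supersolution. At a maximum of \<open>w - \<psi>\<close> the slopes
  agree, so the nonlinear terms differ by \<open>2 * \<psi>1 * (w - \<psi>)\<close>, which an upper
  bound on \<open>\<psi>1\<close> controls.\<close>

lemma upper_barrier: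
  fixes \<psi> \<psi>t \<psi>1 \<psi>2 :: "real \<Rightarrow> real \<Rightarrow> real"
  assumes cont: "continuous_on ({0..T} \<times> {0..1/2}) (\<lambda>(t, x). \<psi> t x)"
    and d: "\<And>t x. 0 < t \<Longrightarrow> t \<le> T \<Longrightarrow> ((\<lambda>s. \<psi> s x) has_real_derivative \<psi>t t x) (at t)"
      "\<And>t x. 0 < t \<Longrightarrow> t \<le> T \<Longrightarrow> (\<psi> t has_real_derivative \<psi>1 t x) (at x)"
      "\<And>t x. 0 < t \<Longrightarrow> t \<le> T \<Longrightarrow> (\<psi>1 t has_real_derivative \<psi>2 t x) (at x)"
    and super: "\<And>t x. 0 < t \<Longrightarrow> t \<le> T \<Longrightarrow> 0 < x \<Longrightarrow> x < 1/2 \<Longrightarrow> \<psi>2 t x + 2 * \<psi> t x * \<psi>1 t x \<le> \<psi>t t x"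
    and slope: "\<And>t x. 0 < t \<Longrightarrow> t \<le> T \<Longrightarrow> 0 < x \<Longrightarrow> x < 1/2 \<Longrightarrow> \<psi>1 t x \<le> C"
    and ends: "\<And>t. 0 < t \<Longrightarrow> t \<le> T \<Longrightarrow> 0 \<le> \<psi> t 0" "\<And>t. 0 < t \<Longrightarrow> t \<le> T \<Longrightarrow> 0 \<le> \<psi> t (1/2)"
    and ini: "\<And>x. 0 \<le> x \<Longrightarrow> x \<le> 1/2 \<Longrightarrow> - k * f x \<le> \<psi> 0 x"
    and t: "0 \<le> t" "t \<le> T" and x: "0 \<le> x" "x \<le> 1/2"
  shows "- u t x \<le> \<psi> t x"
proof -
  have "- u t x - \<psi> t x \<le> 0"
  proof (rule parabolic_maximum_principle[of "{0..1/2::real}" T "\<lambda>t x. - u t x - \<psi> t x" "2 * C" t x])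
    show "continuous_on ({0..T} \<times> {0..1/2}) (\<lambda>(t, x). - u t x - \<psi> t x)"
      using cont unfolding case_prod_unfold by (intro continuous_intros) auto
  next
    fix s x assume s: "0 < s" "s \<le> T" and x: "x \<in> {0..1/2::real}" and pos: "0 < - u s x - \<psi> s x"
      and mx: "\<And>r'. r' \<in> {0..1/2} \<Longrightarrow> - u s r' - \<psi> s r' \<le> - u s x - \<psi> s x"
    have "- u s x - \<psi> s x \<noteq> - u s 0 - \<psi> s 0" "- u s x - \<psi> s x \<noteq> - u s (1/2) - \<psi> s (1/2)"
      using pos u_0[of s] u_half[of s] ends[OF s] s by auto
    then have "x \<noteq> 0" "x \<noteq> 1/2" by metis+
    then have x': "0 < x" "x < 1/2" using x by auto
    have "- ux s x - \<psi>1 s x = 0"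
      by (rule interior_max_deriv_zero[of "\<lambda>x. - u s x - \<psi> s x" "\<lambda>x. - ux s x - \<psi>1 s x" 0 x "1/2"])
        (use mx s x' in \<open>auto intro!: derivative_eq_intros d\<close>)
    then have p: "ux s x = - \<psi>1 s x" by simp
    have D2: "- uxx s x - \<psi>2 s x \<le> 0"
      by (rule interior_max_second_deriv_le[of "\<lambda>x. - u s x - \<psi> s x" "\<lambda>x. - ux s x - \<psi>1 s x" "\<lambda>x. - uxx s x - \<psi>2 s x" 0 x "1/2"])
        (use mx s x' in \<open>auto intro!: derivative_eq_intros d\<close>)
    have "((\<lambda>s. - u s x - \<psi> s x) has_real_derivative - ut s x - \<psi>t s x) (at s)"
      using s by (auto intro!: derivative_eq_intros dt d)
    moreover have "- ut s x - \<psi>t s x \<le> 2 * \<psi>1 s x * (- u s x - \<psi> s x)"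
      using D2 super[OF s x'] by (simp add: eq[OF s(1)] p algebra_simps)
    moreover have "2 * \<psi>1 s x * (- u s x - \<psi> s x) \<le> 2 * C * (- u s x - \<psi> s x)"
      using slope[OF s x'] pos by (intro mult_right_mono) auto
    ultimately show "\<exists>D. ((\<lambda>s. - u s x - \<psi> s x) has_real_derivative D) (at s) \<and> D \<le> 2 * C * (- u s x - \<psi> s x)"
      by force
  qed (use t x ini in \<open>auto simp: init\<close>)
  then show ?thesis by simp
qed

subsection \<open>Barriers, energy and enstrophy\<close>

text \<open>Solution of \<open>r' = - 2 * r^2\<close> with \<open>r 0 = k * L\<close>: the slope of
  a rarefaction wave that starts with the steepest slope of the data.\<close>

definition rate :: "real \<Rightarrow> real" where "rate t = k * L / (1 + 2 * (k * L) * t)"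

lemma rate_denominator: assumes "0 \<le> t" shows "1 \<le> 1 + 2 * (k * L) * t"
  using assms k_pos L_pos by simp

lemma rate_pos: assumes "0 \<le> t" shows "0 < rate t"
  using rate_denominator[OF assms] k_pos L_pos unfolding rate_def by (intro divide_pos_pos mult_pos_pos) linarith+

lemma rate_le: assumes "0 \<le> t" shows "rate t \<le> k * L"
proof -
  have "k * L * 1 \<le> k * L * (1 + 2 * (k * L) * t)"
    using rate_denominator[OF assms] k_pos L_pos by (intro mult_left_mono) auto
  moreover have "0 < 1 + 2 * (k * L) * t" using rate_denominator[OF assms] by linarith
  ultimately show ?thesis by (simp add: rate_def pos_divide_le_eq)
qed

lemma rate_le_inverse: assumes "0 < t" shows "rate t \<le> 1 / (2 * t)"
proof -
  have "k * L * (2 * t) \<le> 1 + 2 * (k * L) * t" by simp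
  moreover have "0 < 1 + 2 * (k * L) * t" using rate_denominator[of t] assms by linarith
  ultimately show ?thesis unfolding rate_def using assms by (subst frac_le_eq) (auto simp: divide_le_0_iff)
qed

lemma DERIV_rate: assumes "0 \<le> t" shows "(rate has_real_derivative - 2 * (rate t)^2) (at t)"
proof -
  have "1 + 2 * (k * L) * t \<noteq> 0" using rate_denominator[OF assms] by linarith
  then show ?thesis unfolding rate_def
    by (auto intro!: derivative_eq_intros simp: divide_simps power2_eq_square)
qed

lemma continuous_on_rate [continuous_intros]:
  assumes "continuous_on S h" "\<And>z. z \<in> S \<Longrightarrow> 0 \<le> h z"
  shows "continuous_on S (\<lambda>z. rate (h z))"
proof -
  have "1 + 2 * (k * L) * h z \<noteq> 0" if "z \<in> S" for z using rate_denominator[OF assms(2)[OF that]] by linarith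
  then show ?thesis unfolding rate_def using assms(1) by (intro continuous_intros) auto
qed

text \<open>The straight line through the zero at \<open>1/2\<close> is an exact solution of the
  equation for \<open>- u\<close>, because its slope follows the characteristics. Its decay like
  \<open>1/t\<close> does not depend on \<open>k\<close>.\<close>

lemma linear_upper_bound:
  assumes "0 \<le> t" "0 \<le> x" "x \<le> 1/2"
  shows "- u t x \<le> rate t * (1/2 - x)"
proof (rule upper_barrier[of t "\<lambda>t x. rate t * (1/2 - x)" "\<lambda>t x. - 2 * (rate t)^2 * (1/2 - x)" "\<lambda>t x. - rate t" "\<lambda>t x. 0" 0])
  show "continuous_on ({0..t} \<times> {0..1/2}) (\<lambda>(t, x). rate t * (1/2 - x))"
    unfolding case_prod_unfold by (intro continuous_intros) auto
  show "- k * f x \<le> rate 0 * (1/2 - x)" if "0 \<le> x" "x \<le> 1/2" for x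
  proof -
    have "- f x \<le> f1 (1/2) * (1/2 - x)" using f_tangent[of "1/2" x] f_half that by (simp add: algebra_simps)
    also have "\<dots> \<le> L * (1/2 - x)" using that by (intro mult_right_mono) (auto simp: L_def)
    finally show ?thesis using k_pos mult_left_mono[of "- f x" "L * (1/2 - x)" k] by (simp add: rate_def algebra_simps)
  qed
qed (use assms in \<open>auto intro!: derivative_eq_intros DERIV_rate less_imp_le[OF rate_pos] simp: power2_eq_square\<close>)

text \<open>By convexity the slope is largest at \<open>1/2\<close>, where the solution touches the
  linear barrier and so cannot be steeper than it.\<close>

lemma ux_upper:
  assumes t: "0 < t" and "0 \<le> x" "x \<le> 1/2"
  shows "ux t x \<le> rate t"
proof -
  have "ux t (1/2) \<le> rate t"
  proof (rule ccontr)
    assume "\<not> ux t (1/2) \<le> rate t"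
    then have "- ux t (1/2) + rate t < 0" by simp
    moreover have "((\<lambda>x. - u t x - rate t * (1/2 - x)) has_real_derivative - ux t (1/2) + rate t) (at (1/2))"
      using t by (auto intro!: derivative_eq_intros)
    ultimately obtain e where e: "e > 0"
      "\<And>h. 0 < h \<Longrightarrow> h < e \<Longrightarrow> - u t (1/2) - rate t * (1/2 - 1/2) < - u t (1/2 - h) - rate t * (1/2 - (1/2 - h))"
      using DERIV_neg_dec_left by blast
    define h where "h = min (e/2) (1/2)"
    have "0 < h" "h < e" "h \<le> 1/2" using e by (auto simp: h_def)
    then show False using e(2)[of h] linear_upper_bound[of t "1/2 - h"] t u_half[of t] by simp
  qed
  then show ?thesis using ux_mono[of t x "1/2"] assms by auto
qed

text \<open>The residual of the equation for this function factors as
  \<open>(b' t + 2 * a t * b t) * (\<tau> + b t * x * (1 - \<tau>^2))\<close> with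
  \<open>\<tau> = tanh (b t * x)\<close>. It vanishes for the exact shock law and is nonnegative if
  \<open>b\<close> decays more slowly. The assumption \<open>right\<close> makes the barrier
  nonnegative at \<open>1/2\<close>.\<close>

lemma tanh_upper_bound:
  assumes da: "\<And>t. 0 \<le> t \<Longrightarrow> t \<le> T \<Longrightarrow> (a has_real_derivative - 2 * (a t)^2) (at t)"
    and db: "\<And>t. 0 \<le> t \<Longrightarrow> t \<le> T \<Longrightarrow> (b has_real_derivative b' t) (at t)"
    and b': "\<And>t. 0 \<le> t \<Longrightarrow> t \<le> T \<Longrightarrow> - 2 * a t * b t \<le> b' t"
    and b: "\<And>t. 0 \<le> t \<Longrightarrow> t \<le> T \<Longrightarrow> 0 \<le> b t"
    and right: "\<And>t. 0 \<le> t \<Longrightarrow> t \<le> T \<Longrightarrow> a t / 2 \<le> b t * tanh (b t / 2)"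
    and ini: "\<And>x. 0 \<le> x \<Longrightarrow> x \<le> 1/2 \<Longrightarrow> - k * f x \<le> - a 0 * x + b 0 * tanh (b 0 * x)"
    and t: "0 \<le> t" "t \<le> T" and x: "0 \<le> x" "x \<le> 1/2"
  shows "- u t x \<le> - a t * x + b t * tanh (b t * x)"
proof -
  have ca: "continuous_on {0..T} a" and cb: "continuous_on {0..T} b"
    using da db by (auto intro!: DERIV_continuous_on[THEN continuous_on_subset[of _ _ "{0..T}"]] continuous_at_imp_continuous_on DERIV_isCont)
  have "compact ((\<lambda>t. \<bar>a t\<bar> + (b t)^2) ` {0..T})"
    by (intro compact_continuous_image continuous_intros ca cb) auto
  then obtain B where B: "\<And>t. 0 \<le> t \<Longrightarrow> t \<le> T \<Longrightarrow> \<bar>a t\<bar> + (b t)^2 \<le> B"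
    by (fastforce dest!: compact_imp_bounded simp: bounded_iff)
  define \<tau> where "\<tau> = (\<lambda>t x. tanh (b t * x))"
  have \<tau>: "0 \<le> \<tau> t x" "(\<tau> t x)^2 \<le> 1" if "0 \<le> t" "t \<le> T" "0 \<le> x" for t x
    using b[OF that(1,2)] that tanh_real_bounds[of "b t * x"] by (auto simp: \<tau>_def abs_square_le_1 abs_le_iff)
  show ?thesis
  proof (rule upper_barrier[of T "\<lambda>t x. - a t * x + b t * tanh (b t * x)"
        "\<lambda>t x. 2 * (a t)^2 * x + b' t * \<tau> t x + b t * b' t * x * (1 - (\<tau> t x)^2)"
        "\<lambda>t x. - a t + (b t)^2 * (1 - (\<tau> t x)^2)" "\<lambda>t x. - 2 * (b t)^3 * \<tau> t x * (1 - (\<tau> t x)^2)" B t x])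
    show "continuous_on ({0..T} \<times> {0..1/2}) (\<lambda>(t, x). - a t * x + b t * tanh (b t * x))"
      unfolding case_prod_unfold
      by (intro continuous_intros continuous_on_compose2[OF ca] continuous_on_compose2[OF cb]) auto
  next
    fix s y assume s: "0 < s" "s \<le> T" and y: "0 < y" "y < (1/2::real)"
    have "0 \<le> b' s + 2 * a s * b s" using b'[of s] s by simp
    moreover have "0 \<le> \<tau> s y + b s * y * (1 - (\<tau> s y)^2)" using b[of s] \<tau>[of s y] s y by simp
    ultimately have "0 \<le> (b' s + 2 * a s * b s) * (\<tau> s y + b s * y * (1 - (\<tau> s y)^2))"
      by (rule mult_nonneg_nonneg)
    then show "- 2 * (b s)^3 * \<tau> s y * (1 - (\<tau> s y)^2)
        + 2 * (- a s * y + b s * tanh (b s * y)) * (- a s + (b s)^2 * (1 - (\<tau> s y)^2))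
      \<le> 2 * (a s)^2 * y + b' s * \<tau> s y + b s * b' s * y * (1 - (\<tau> s y)^2)"
      unfolding \<tau>_def[symmetric] by (simp add: algebra_simps power2_eq_square power3_eq_cube \<tau>_def)
    have "(b s)^2 * (1 - (\<tau> s y)^2) \<le> (b s)^2 * 1" by (intro mult_left_mono) auto
    then show "- a s + (b s)^2 * (1 - (\<tau> s y)^2) \<le> B" using B[of s] s by linarith
  qed (use t x right ini in \<open>auto intro!: derivative_eq_intros da db simp: \<tau>_def power2_eq_square power3_eq_cube algebra_simps\<close>)
qed

section \<open>Energy balance and enstrophy under a barrier\<close>

lemma energy_eq: assumes "0 \<le> t" shows "energy (u t) = integral {0..1/2} (\<lambda>x. (u t x)^2)"
  unfolding energy_def using assms
  by (subst integral_even) (auto simp: u_odd intro!: continuous_intros)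

lemma enstrophy_eq: assumes "0 < t" shows "enstrophy (u t) = integral {0..1/2} (\<lambda>x. (ux t x)^2)"
proof -
  have "deriv (u t) = ux t" using assms by (auto intro!: DERIV_imp_deriv dx)
  then show ?thesis unfolding enstrophy_def using assms
    by (subst integral_even) (auto simp: ux_even intro!: continuous_intros)
qed

lemma continuous_on_energy: "continuous_on {0..} (\<lambda>t. energy (u t))"
proof -
  have "continuous_on {0..} (\<lambda>t. integral (cbox 0 (1/2)) (\<lambda>x. (u t x)^2))"
    by (rule integral_continuous_on_param) (auto simp: case_prod_unfold intro!: continuous_intros)
  then show ?thesis by (rule continuous_on_eq) (auto simp: energy_eq)
qed

lemma continuous_on_enstrophy: "continuous_on {0<..} (\<lambda>t. enstrophy (u t))"
proof -
  have "continuous_on {0<..} (\<lambda>t. integral (cbox 0 (1/2)) (\<lambda>x. (ux t x)^2))"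
    by (rule integral_continuous_on_param) (auto simp: case_prod_unfold intro!: continuous_intros)
  then show ?thesis by (rule continuous_on_eq) (auto simp: enstrophy_eq)
qed

lemma enstrophy_by_parts:
  assumes t: "0 < t"
  shows "enstrophy (u t) = integral {0..1/2} (\<lambda>x. - u t x * uxx t x)"
proof -
  have "((\<lambda>x. (ux t x)^2 + u t x * uxx t x) has_integral (u t (1/2) * ux t (1/2) - u t 0 * ux t 0)) {0..1/2}"
    by (rule has_integral_of_DERIV[of "\<lambda>x. u t x * ux t x"])
      (use t in \<open>auto simp: power2_eq_square intro!: derivative_eq_intros\<close>)
  then have z: "integral {0..1/2} (\<lambda>x. (ux t x)^2 + u t x * uxx t x) = 0"
    using t u_0[of t] u_half[of t] by (auto dest: integral_unique)
  have "integral {0..1/2} (\<lambda>x. (ux t x)^2 + u t x * uxx t x) =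
     integral {0..1/2} (\<lambda>x. (ux t x)^2) - integral {0..1/2} (\<lambda>x. - u t x * uxx t x)"
    using t by (subst Henstock_Kurzweil_Integration.integral_diff[symmetric])
      (auto intro!: integrable_continuous_interval continuous_intros)
  then show ?thesis using z enstrophy_eq[OF t] by simp
qed

lemma DERIV_energy:
  assumes t: "0 < t"
  shows "((\<lambda>t. energy (u t)) has_real_derivative - 2 * enstrophy (u t)) (at t)"
proof -
  have "((\<lambda>t. integral (cbox 0 (1/2)) (\<lambda>x. (u t x)^2)) has_real_derivative
      integral (cbox 0 (1/2)) (\<lambda>x. 2 * u t x * ut t x)) (at t within {0<..})"
  proof (rule leibniz_rule_field_derivative)
    show "((\<lambda>t. (u t x)^2) has_real_derivative 2 * u s x * ut s x) (at s within {0<..})" if "s \<in> {0<..}" for s x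
      using that by (auto intro!: derivative_eq_intros has_field_derivative_at_within[OF dt])
  qed (use t in \<open>auto simp: case_prod_unfold intro!: integrable_continuous_interval continuous_intros\<close>)
  then have 1: "((\<lambda>t. integral {0..1/2} (\<lambda>x. (u t x)^2)) has_real_derivative
      integral {0..1/2} (\<lambda>x. 2 * u t x * ut t x)) (at t)"
    using t by (simp add: at_within_open[of t "{0<..}"])
  \<comment> \<open>The flux \<open>- 4/3 * (u t x)^3\<close> accounts for the nonlinear part of
    \<open>ut\<close>, and all boundary values vanish with \<open>u\<close>.\<close>
  have "((\<lambda>x. 2 * (ux t x)^2 + 2 * u t x * ut t x) has_integral
     ((2 * u t (1/2) * ux t (1/2) - 4/3 * (u t (1/2))^3) - (2 * u t 0 * ux t 0 - 4/3 * (u t 0)^3))) {0..1/2}"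
    by (rule has_integral_of_DERIV[of "\<lambda>x. 2 * u t x * ux t x - 4/3 * (u t x)^3"])
      (use t in \<open>auto simp: power2_eq_square eq algebra_simps intro!: derivative_eq_intros\<close>)
  then have z: "integral {0..1/2} (\<lambda>x. 2 * (ux t x)^2 + 2 * u t x * ut t x) = 0"
    using t u_0[of t] u_half[of t] by (auto dest: integral_unique)
  have "integral {0..1/2} (\<lambda>x. 2 * (ux t x)^2 + 2 * u t x * ut t x) =
     2 * integral {0..1/2} (\<lambda>x. (ux t x)^2) + integral {0..1/2} (\<lambda>x. 2 * u t x * ut t x)"
    using t by (subst Henstock_Kurzweil_Integration.integral_add)
      (auto intro!: integrable_continuous_interval continuous_intros)
  then have "integral {0..1/2} (\<lambda>x. 2 * u t x * ut t x) = - 2 * enstrophy (u t)"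
    using z enstrophy_eq[OF t] by simp
  moreover have "eventually (\<lambda>s. energy (u s) = integral {0..1/2} (\<lambda>x. (u s x)^2)) (nhds t)"
    using eventually_nhds_in_open[of "{0<..}" t] t by (auto elim!: eventually_mono simp: energy_eq)
  ultimately show ?thesis using 1 by (simp add: DERIV_cong_ev)
qed

text \<open>Integrating by parts twice moves the second derivative onto the barrier; convexity of the solution
  gives the signs that allow replacing the solution by the barrier before and after this step.\<close>

lemma enstrophy_le:
  assumes t: "0 < t" and b: "0 \<le> b"
    and le: "\<And>x. 0 \<le> x \<Longrightarrow> x \<le> 1/2 \<Longrightarrow> - u t x \<le> - a * x + b * tanh (b * x)"
  shows "enstrophy (u t) \<le> 2/3 * b^3 + \<bar>a\<bar> * b + (\<bar>a\<bar> + b) * (k * L)"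
proof -
  define \<tau> where "\<tau> = (\<lambda>x. tanh (b * x))"
  define \<phi> where "\<phi> = (\<lambda>x. - a * x + b * \<tau> x)"
  define \<phi>1 where "\<phi>1 = (\<lambda>x. - a + b^2 * (1 - (\<tau> x)^2))"
  define \<phi>2 where "\<phi>2 = (\<lambda>x. - 2 * b^3 * \<tau> x * (1 - (\<tau> x)^2))"
  have \<tau>: "0 \<le> \<tau> x" "\<tau> x \<le> 1" "(\<tau> x)^2 \<le> 1" if "0 \<le> x" for x
    using b that tanh_real_bounds[of "b * x"] by (auto simp: \<tau>_def abs_square_le_1 abs_le_iff)
  have c\<tau>: "continuous_on S \<tau>" for S unfolding \<tau>_def by (intro continuous_intros) auto
  have d\<tau>: "(\<tau> has_real_derivative b * (1 - (\<tau> x)^2)) (at x)" for x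
    unfolding \<tau>_def by (auto intro!: derivative_eq_intros)
  have d\<phi>: "(\<phi> has_real_derivative \<phi>1 x) (at x)" "(\<phi>1 has_real_derivative \<phi>2 x) (at x)" for x
    unfolding \<phi>_def \<phi>1_def \<phi>2_def
    by (auto intro!: derivative_eq_intros d\<tau> simp: power2_eq_square power3_eq_cube algebra_simps)
  have c\<phi>: "continuous_on S \<phi>" "continuous_on S \<phi>1" "continuous_on S \<phi>2" for S
    unfolding \<phi>_def \<phi>1_def \<phi>2_def by (auto intro!: continuous_intros c\<tau>)
  have E: "enstrophy (u t) \<le> integral {0..1/2} (\<lambda>x. \<phi> x * uxx t x)"
    unfolding enstrophy_by_parts[OF t]
    by (intro integral_le integrable_continuous_interval continuous_intros c\<phi> mult_right_mono)
      (use t le uxx_nonneg[OF t] in \<open>auto simp: \<phi>_def \<tau>_def\<close>)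
  have "((\<lambda>x. \<phi> x * uxx t x - \<phi>2 x * u t x) has_integral
      (\<phi> (1/2) * ux t (1/2) - \<phi>1 (1/2) * u t (1/2)) - (\<phi> 0 * ux t 0 - \<phi>1 0 * u t 0)) {0..1/2}"
    by (rule has_integral_of_DERIV[of "\<lambda>x. \<phi> x * ux t x - \<phi>1 x * u t x"])
      (use t in \<open>auto simp: algebra_simps intro!: derivative_eq_intros d\<phi>\<close>)
  then have "integral {0..1/2} (\<lambda>x. \<phi> x * uxx t x - \<phi>2 x * u t x) = \<phi> (1/2) * ux t (1/2)"
    using t u_0[of t] u_half[of t] by (auto dest!: integral_unique simp: \<phi>_def \<tau>_def)
  moreover have "integral {0..1/2} (\<lambda>x. \<phi> x * uxx t x - \<phi>2 x * u t x) =
     integral {0..1/2} (\<lambda>x. \<phi> x * uxx t x) - integral {0..1/2} (\<lambda>x. \<phi>2 x * u t x)"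
    using t by (subst Henstock_Kurzweil_Integration.integral_diff)
      (auto intro!: integrable_continuous_interval continuous_intros c\<phi>)
  ultimately have E2: "enstrophy (u t) \<le> \<phi> (1/2) * ux t (1/2) + integral {0..1/2} (\<lambda>x. \<phi>2 x * u t x)"
    using E by simp
  have \<phi>half: "0 \<le> \<phi> (1/2)" "\<phi> (1/2) \<le> \<bar>a\<bar> + b"
    using le[of "1/2"] u_half[of t] t \<tau>[of "1/2"] mult_left_mono[OF \<tau>(2)[of "1/2"] b] by (auto simp: \<phi>_def \<tau>_def)
  \<comment> \<open>At \<open>1/2\<close> only the expansive slope enters, at most
    \<open>k * L\<close>, so this boundary term is of lower order than the layer term
    \<open>b^3\<close>.\<close>
  have "\<phi> (1/2) * ux t (1/2) \<le> \<phi> (1/2) * (k * L)"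
    using ux_upper[OF t, of "1/2"] rate_le[of t] t \<phi>half by (intro mult_left_mono) auto
  also have "\<dots> \<le> (\<bar>a\<bar> + b) * (k * L)" using \<phi>half k_pos L_pos by (intro mult_right_mono) auto
  finally have E3: "\<phi> (1/2) * ux t (1/2) \<le> (\<bar>a\<bar> + b) * (k * L)" .
  \<comment> \<open>\<open>G\<close> is an antiderivative of \<open>g\<close>. Its last term comes
    from the pure shock, the first from the interaction of the line with the layer.\<close>
  define G where "G = (\<lambda>x. \<bar>a\<bar> * (b * \<tau> x - b^2 * x * (1 - (\<tau> x)^2)) + 2/3 * b^3 * (\<tau> x)^3)"
  define g where "g = (\<lambda>x. (\<bar>a\<bar> * x + b * \<tau> x) * (2 * b^3 * \<tau> x * (1 - (\<tau> x)^2)))"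
  have "(g has_integral G (1/2) - G 0) {0..1/2}"
    unfolding G_def g_def
    by (rule has_integral_of_DERIV)
      (auto simp: power2_eq_square power3_eq_cube field_simps intro!: derivative_eq_intros d\<tau>)
  then have gi: "integral {0..1/2} g = G (1/2)" by (auto dest!: integral_unique simp: G_def \<tau>_def)
  have "integral {0..1/2} (\<lambda>x. \<phi>2 x * u t x) \<le> integral {0..1/2} g"
  proof (intro integral_le integrable_continuous_interval continuous_intros c\<phi>)
    show "continuous_on {0..1/2} g" unfolding g_def by (intro continuous_intros c\<tau>)
    fix x assume x: "x \<in> {0..1/2::real}"
    have "- u t x \<le> \<bar>a\<bar> * x + b * \<tau> x"
      using le[of x] x mult_right_mono[OF abs_ge_minus_self[of a], of x] by (auto simp: \<tau>_def)
    then have "- u t x * (2 * b^3 * \<tau> x * (1 - (\<tau> x)^2)) \<le> g x"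
      unfolding g_def using b \<tau>[of x] x by (intro mult_right_mono) auto
    then show "\<phi>2 x * u t x \<le> g x" by (simp add: \<phi>2_def algebra_simps)
  qed (use t in auto)
  also note gi
  also have "G (1/2) \<le> \<bar>a\<bar> * b + 2/3 * b^3"
  proof -
    have "0 \<le> b^2 * (1/2) * (1 - (\<tau> (1/2))^2)" using \<tau>[of "1/2"] by (intro mult_nonneg_nonneg) auto
    moreover have "b * \<tau> (1/2) \<le> b * 1" using \<tau>[of "1/2"] b by (intro mult_left_mono) auto
    ultimately have "b * \<tau> (1/2) - b^2 * (1/2) * (1 - (\<tau> (1/2))^2) \<le> b" by linarith
    moreover have "b^3 * (\<tau> (1/2))^3 \<le> b^3 * 1" using \<tau>[of "1/2"] b by (intro mult_left_mono power_le_one) auto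
    ultimately show ?thesis unfolding G_def using mult_left_mono[of _ b "\<bar>a\<bar>"] by fastforce
  qed
  finally show ?thesis using E2 E3 by simp
qed

lemma energy_antimono: assumes "0 \<le> s" "s \<le> t" shows "energy (u t) \<le> energy (u s)"
proof -
  have "- energy (u s) \<le> - energy (u t)"
  proof (rule DERIV_nonneg_imp_increasing_open[of s t "\<lambda>t. - energy (u t)"])
    fix x assume "s < x" "x < t"
    then have "((\<lambda>t. - energy (u t)) has_real_derivative - (- 2 * enstrophy (u x))) (at x)"
      using assms by (intro DERIV_minus DERIV_energy) auto
    then show "\<exists>y. ((\<lambda>t. - energy (u t)) has_real_derivative y) (at x) \<and> 0 \<le> y"
      using enstrophy_nonneg[of "u x"] by auto
  next
    show "continuous_on {s..t} (\<lambda>t. - energy (u t))"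
      using continuous_on_subset[OF continuous_on_energy, of "{s..t}"] assms by (intro continuous_intros) auto
  qed (use assms in auto)
  then show ?thesis by simp
qed

text \<open>The line \<open>\<alpha> s + \<beta>\<close> above the initial profile is transported along characteristics, and the
  boundary layer at \<open>0\<close> is a viscous shock of half-height slightly above \<open>\<beta>\<close>.\<close>

lemma enstrophy_le_line:
  fixes \<alpha> \<beta> \<theta> A \<rho> D \<epsilon> :: real
  assumes line: "\<And>s. 0 \<le> s \<Longrightarrow> s \<le> 1/2 \<Longrightarrow> - f s \<le> \<alpha> * s + \<beta>"
    and A: "1 \<le> A" "\<bar>\<alpha>\<bar> \<le> A" "0 \<le> \<beta>" "\<beta> \<le> A"
    and \<rho>: "0 < \<rho>" "\<rho> \<le> 1" "\<rho> \<le> 1 - 2 * \<alpha> * \<theta>" and D: "1 \<le> D" "1 - 2 * \<alpha> * \<theta> \<le> D"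
    and \<epsilon>: "0 < \<epsilon>" "\<epsilon> \<le> 1" and \<theta>: "0 < \<theta>"
    and k: "2 * A * D / \<epsilon>^2 + (L + A) * (1 + A / \<epsilon>) / \<epsilon>^2 \<le> k"
  shows "enstrophy (u (\<theta> / k)) \<le> k^3 * (2/3 * ((\<beta> + \<epsilon>) / (1 - 2 * \<alpha> * \<theta>))^3) + k^2 * (2 * A^2 / \<rho>^2 + 3 * A * L / \<rho>)"
proof -
  define d where "d = (\<lambda>t. 1 - 2 * \<alpha> * k * t)"
  define a where "a = (\<lambda>t. - k * \<alpha> / d t)"
  define b where "b = (\<lambda>t. k * (\<beta> + \<epsilon>) / d t)"
  define T where "T = \<theta> / k"
  have T: "0 < T" "k * T = \<theta>" using \<theta> k_pos by (auto simp: T_def)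
  have d: "\<rho> \<le> d t" "d t \<le> D" if "0 \<le> t" "t \<le> T" for t
  proof -
    have kt: "0 \<le> k * t" "k * t \<le> \<theta>" using that k_pos T mult_left_mono[of t T k] by auto
    show "\<rho> \<le> d t" 
    proof (cases "0 \<le> \<alpha>")
      case True
      then have "\<alpha> * (k * t) \<le> \<alpha> * \<theta>" using kt by (intro mult_left_mono)
      then show ?thesis using \<rho> by (simp add: d_def mult.assoc)
    next
      case False
      then have "\<alpha> * (k * t) \<le> 0" using kt by (simp add: mult_nonpos_nonneg)
      then show ?thesis using \<rho> by (simp add: d_def mult.assoc)
    qed
    show "d t \<le> D"
    proof (cases "0 \<le> \<alpha>")
      case True
      then have "0 \<le> \<alpha> * (k * t)" using kt by simp
      then show ?thesis using D by (simp add: d_def mult.assoc)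
    next
      case False
      then have "\<alpha> * \<theta> \<le> \<alpha> * (k * t)" using kt by (intro mult_left_mono_neg) auto
      then show ?thesis using D by (simp add: d_def mult.assoc)
    qed
  qed
  have dpos: "0 < d t" if "0 \<le> t" "t \<le> T" for t using d(1)[OF that] \<rho> by linarith
  \<comment> \<open>The first threshold makes the barrier nonnegative at \<open>1/2\<close>, where
    the surplus \<open>\<epsilon>\<close> has to compensate for \<open>tanh\<close> being below
    \<open>1\<close>. The second lets the barrier rise faster than the data inside the initial
    layer.\<close>
  have k1: "2 * A * D / \<epsilon>^2 \<le> k" "(L + A) * (1 + A / \<epsilon>) / \<epsilon>^2 \<le> k"
    using k A D \<epsilon> L_pos by (auto intro!: order_trans[OF _ k] simp: divide_nonneg_pos)
  have bound: "- u T x \<le> - a T * x + b T * tanh (b T * x)" if "0 \<le> x" "x \<le> 1/2" for x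
  proof (rule tanh_upper_bound[of T a b "\<lambda>t. - 2 * a t * b t" T x])
    fix t assume t: "0 \<le> t" "t \<le> T"
    note p = dpos[OF t]
    have dd: "(d has_real_derivative - 2 * \<alpha> * k) (at t)" unfolding d_def by (auto intro!: derivative_eq_intros)
    show "(a has_real_derivative - 2 * (a t)^2) (at t)"
      unfolding a_def using p by (auto intro!: derivative_eq_intros dd simp: field_simps power2_eq_square)
    show "(b has_real_derivative - 2 * a t * b t) (at t)"
      unfolding a_def b_def using p by (auto intro!: derivative_eq_intros dd simp: field_simps power2_eq_square)
    show b0: "0 \<le> b t" unfolding b_def using p k_pos A \<epsilon> by simp
    have "2 * A * D \<le> k * \<epsilon>^2" using k1(1) \<epsilon> by (simp add: pos_divide_le_eq)
    then have "2 * A * D \<le> \<epsilon> * (k * \<epsilon>)" by (simp add: power2_eq_square ac_simps)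
    also have "\<dots> \<le> \<epsilon> * (k * (\<beta> + \<epsilon>))" using \<epsilon> k_pos A by (intro mult_left_mono) auto
    finally have "2 * A * D \<le> \<epsilon> * (k * (\<beta> + \<epsilon>))" .
    moreover have "2 * A * d t \<le> 2 * A * D" using d(2)[OF t] A by (intro mult_left_mono) auto
    ultimately have "2 * A * d t \<le> \<epsilon> * (k * (\<beta> + \<epsilon>))" by linarith
    then have "2 * A \<le> \<epsilon> * b t" unfolding b_def using p by (simp add: pos_le_divide_eq)
    then have e: "2 * \<beta> \<le> \<epsilon> * b t" using A by linarith
    have "- \<alpha> / 2 \<le> \<beta>" using line[of "1/2"] f_half by simp
    also have "\<beta> \<le> (\<beta> + \<epsilon>) * ((b t / 2) / (1 + b t / 2))"
      using e b0 by (simp add: field_simps)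
    also have "\<dots> \<le> (\<beta> + \<epsilon>) * tanh (b t / 2)" using b0 A \<epsilon> by (intro mult_left_mono tanh_ge) auto
    finally have "- \<alpha> / 2 \<le> (\<beta> + \<epsilon>) * tanh (b t / 2)" .
    then have "k / d t * (- \<alpha> / 2) \<le> k / d t * ((\<beta> + \<epsilon>) * tanh (b t / 2))" using k_pos p by (intro mult_left_mono) auto
    then show "a t / 2 \<le> b t * tanh (b t / 2)" by (simp add: a_def b_def)
  next
    fix x :: real assume x: "0 \<le> x" "x \<le> 1/2"
    \<comment> \<open>\<open>M\<close> marks the edge of the layer: from \<open>c * x = M\<close>
      on, \<open>tanh\<close> is at least \<open>M / (1 + M)\<close>, and
      \<open>(\<beta> + \<epsilon>) * M / (1 + M) \<ge> \<beta>\<close> because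
      \<open>\<beta> \<le> A = M * \<epsilon>\<close>.\<close>
    define M where "M = A / \<epsilon>"
    define c where "c = k * (\<beta> + \<epsilon>)"
    have M: "0 < M" "M * \<epsilon> = A" using A \<epsilon> by (auto simp: M_def)
    have c: "0 < c" using k_pos A \<epsilon> by (simp add: c_def)
    have "- k * f x \<le> k * \<alpha> * x + c * tanh (c * x)"
    proof (cases "M \<le> c * x")
      case True
      have "\<beta> \<le> (\<beta> + \<epsilon>) * (M / (1 + M))" using M A by (simp add: field_simps)
      also have "\<dots> \<le> (\<beta> + \<epsilon>) * tanh M" using M A \<epsilon> by (intro mult_left_mono tanh_ge) auto
      also have "\<dots> \<le> (\<beta> + \<epsilon>) * tanh (c * x)" using True A \<epsilon> by (intro mult_left_mono) auto
      finally have "k * (- f x) \<le> k * (\<alpha> * x + (\<beta> + \<epsilon>) * tanh (c * x))"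
        using line[OF x] k_pos by (intro mult_left_mono) auto
      then show ?thesis by (simp add: c_def algebra_simps)
    next
      case False
      \<comment> \<open>Inside the layer \<open>c * tanh (c * x)\<close> is at least
        \<open>c^2 * x / (1 + M)\<close>. This is quadratic in \<open>k\<close>, while the data and
        the line are only linear in \<open>k\<close>.\<close>
      have "(L + A) * (1 + M) \<le> k * \<epsilon>^2" using k1(2) \<epsilon> by (simp add: pos_divide_le_eq M_def)
      then have "(L + A) * (1 + M) * (k * x) \<le> k * \<epsilon>^2 * (k * x)" using k_pos x by (intro mult_right_mono) auto
      also have "\<dots> = (k * \<epsilon>)^2 * x" by (simp add: power2_eq_square)
      also have "\<dots> \<le> c^2 * x" using x k_pos \<epsilon> A by (intro mult_right_mono power_mono) (auto simp: c_def)
      finally have "k * ((L + A) * x) \<le> c^2 * x / (1 + M)" using M by (simp add: pos_le_divide_eq ac_simps)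
      also have "\<dots> \<le> c^2 * x / (1 + c * x)" using False c x M by (intro divide_left_mono mult_pos_pos add_pos_nonneg) auto
      also have "\<dots> = c * (c * x / (1 + c * x))" by (simp add: power2_eq_square)
      also have "\<dots> \<le> c * tanh (c * x)" using c x by (intro mult_left_mono tanh_ge) auto
      finally have 1: "k * ((L + A) * x) \<le> c * tanh (c * x)" .
      have "- A * x \<le> \<alpha> * x" using A x by (intro mult_right_mono) auto
      then have "- f x \<le> (L + A) * x + \<alpha> * x" using f_le_linear[OF x] by (simp add: algebra_simps)
      then have "k * (- f x) \<le> k * ((L + A) * x + \<alpha> * x)" using k_pos by (intro mult_left_mono) auto
      with 1 show ?thesis by (simp add: algebra_simps)
    qed
    then show "- k * f x \<le> - a 0 * x + b 0 * tanh (b 0 * x)"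
      by (simp add: a_def b_def d_def c_def)
  qed (use that T in auto)
  have dT: "d T = 1 - 2 * \<alpha> * \<theta>" using T by (simp add: d_def mult.assoc)
  have dT': "\<rho> \<le> d T" "0 < d T" using d[of T] dpos[of T] T by auto
  have b: "0 \<le> b T" "b T \<le> 2 * A / \<rho> * k"
  proof -
    show "0 \<le> b T" unfolding b_def using dT' k_pos A \<epsilon> by simp
    have "k * (\<beta> + \<epsilon>) / d T \<le> k * (2 * A) / \<rho>" using dT' k_pos A \<epsilon> \<rho> by (intro frac_le mult_left_mono) auto
    then show "b T \<le> 2 * A / \<rho> * k" by (simp add: b_def ac_simps)
  qed
  have a: "\<bar>a T\<bar> \<le> A / \<rho> * k"
  proof -
    have "\<bar>a T\<bar> = k * \<bar>\<alpha>\<bar> / d T" using dT' k_pos by (simp add: a_def abs_mult abs_divide)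
    also have "\<dots> \<le> k * A / \<rho>" using dT' k_pos A \<rho> by (intro frac_le mult_left_mono) auto
    finally show ?thesis by (simp add: ac_simps)
  qed
  have b3: "(b T)^3 = k^3 * ((\<beta> + \<epsilon>) / (1 - 2 * \<alpha> * \<theta>))^3"
    by (simp add: b_def dT power_mult_distrib power_divide)
  have "enstrophy (u T) \<le> 2/3 * (b T)^3 + \<bar>a T\<bar> * b T + (\<bar>a T\<bar> + b T) * (k * L)"
    using T b bound by (intro enstrophy_le) auto
  also have "\<dots> \<le> 2/3 * (b T)^3 + (A / \<rho> * k) * (2 * A / \<rho> * k) + (A / \<rho> * k + 2 * A / \<rho> * k) * (k * L)"
    using a b k_pos L_pos A \<rho> by (intro add_mono mult_mono order_refl) auto
  also have "\<dots> = k^3 * (2/3 * ((\<beta> + \<epsilon>) / (1 - 2 * \<alpha> * \<theta>))^3) + k^2 * (2 * A^2 / \<rho>^2 + 3 * A * L / \<rho>)"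
    unfolding b3 by (simp add: power2_eq_square algebra_simps)
  finally show ?thesis by (simp add: T_def)
qed

section \<open>Bounds for all times\<close>

lemma tanh_layer_bound:
  assumes t: "0 \<le> t" and x: "0 \<le> x" "x \<le> 1/2"
  shows "- u t x \<le> - rate t * x + (2 * rate t + 2) * tanh ((2 * rate t + 2) * x)"
\<comment> \<open>Here the line falls like a rarefaction, so nothing focuses and the barrier lives
  forever, at the price of a constant factor. The half-height \<open>2 * rate t + 2\<close> has the
  derivative of \<open>2 * rate t\<close>, hence decays more slowly than the exact law. The summand
  \<open>2\<close> gives \<open>tanh \<ge> 1/2\<close> at the right end and
  \<open>1 + c * x \<le> c\<close> for the initial comparison.\<close>
proof (rule tanh_upper_bound[of t rate "\<lambda>t. 2 * rate t + 2" "\<lambda>t. - 4 * (rate t)^2"])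
  fix s assume s: "0 \<le> s" "s \<le> t"
  show "((\<lambda>t. 2 * rate t + 2) has_real_derivative - 4 * (rate s)^2) (at s)"
    using s by (auto intro!: derivative_eq_intros DERIV_rate)
  show "- 2 * rate s * (2 * rate s + 2) \<le> - 4 * (rate s)^2"
    using rate_pos[OF s(1)] by (simp add: power2_eq_square algebra_simps)
  show "0 \<le> 2 * rate s + 2" using rate_pos[OF s(1)] by simp
  define c where "c = 2 * rate s + 2"
  have c: "2 \<le> c" "2 * rate s \<le> c" using rate_pos[OF s(1)] by (auto simp: c_def)
  have "1/2 \<le> (c / 2) / (1 + c / 2)" using c by (simp add: field_simps)
  also have "\<dots> \<le> tanh (c / 2)" using c by (intro tanh_ge) auto
  finally have "c * (1/2) \<le> c * tanh (c / 2)" using c by (intro mult_left_mono) auto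
  then have "rate s / 2 \<le> c * tanh (c / 2)" using c rate_pos[OF s(1)] by linarith
  then show "rate s / 2 \<le> (2 * rate s + 2) * tanh ((2 * rate s + 2) / 2)" by (simp only: c_def)
next
  fix x :: real assume x: "0 \<le> x" "x \<le> 1/2"
  define c where "c = 2 * (k * L) + 2"
  have kL: "0 < k * L" using k_pos L_pos by simp
  have c: "2 \<le> c" "2 * (k * L) \<le> c" using kL by (auto simp: c_def)
  have "c * x \<le> c * (1/2)" using c x by (intro mult_left_mono) auto
  then have "1 + c * x \<le> c" using c by linarith
  then have 1: "1 \<le> c / (1 + c * x)" using c x by (simp add: add_pos_nonneg pos_le_divide_eq)
  have "2 * (k * L) * x \<le> c * x * 1" using c x by (simp add: mult_right_mono)
  also have "\<dots> \<le> c * x * (c / (1 + c * x))" using c x 1 by (intro mult_left_mono) auto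
  also have "\<dots> = c * (c * x / (1 + c * x))" by simp
  also have "\<dots> \<le> c * tanh (c * x)" using c x by (intro mult_left_mono tanh_ge) auto
  finally have "2 * (k * L) * x \<le> c * tanh (c * x)" .
  moreover have "k * (- f x) \<le> k * (L * x)" using f_le_linear[OF x] k_pos by (intro mult_left_mono) auto
  ultimately show "- k * f x \<le> - rate 0 * x + (2 * rate 0 + 2) * tanh ((2 * rate 0 + 2) * x)"
    by (simp add: rate_def c_def algebra_simps)
qed (use assms DERIV_rate in auto)

lemma enstrophy_le_rate:
  assumes t: "0 < t"
  shows "enstrophy (u t) \<le> 2/3 * (2 * rate t + 2)^3 + rate t * (2 * rate t + 2) + (3 * rate t + 2) * (k * L)"
  using enstrophy_le[OF t, of "2 * rate t + 2" "rate t"] tanh_layer_bound[of t] rate_pos[of t] t by auto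

lemma enstrophy_upper:
  assumes t: "0 < t" and k: "1 \<le> k" "1 \<le> k * L"
  shows "enstrophy (u t) \<le> (43 * L^3 + 9 * L^2) * k^3"
proof -
  define r where "r = rate t"
  define K where "K = k * L"
  have r: "0 \<le> r" "r \<le> K" using rate_pos[of t] rate_le[of t] t by (auto simp: r_def K_def)
  have K: "1 \<le> K" using k by (simp add: K_def)
  have "enstrophy (u t) \<le> 2/3 * (2 * r + 2)^3 + r * (2 * r + 2) + (3 * r + 2) * K"
    using enstrophy_le_rate[OF t] by (simp add: r_def K_def)
  also have "\<dots> \<le> 2/3 * (4 * K)^3 + K * (4 * K) + (5 * K) * K"
    using r K by (intro add_mono mult_mono mult_left_mono power_mono) auto
  also have "\<dots> = 128/3 * K^3 + 9 * K^2" by (simp add: power3_eq_cube power2_eq_square)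
  \<comment> \<open>\<open>43\<close> rounds up \<open>128/3 = 2/3 * 4^3\<close>, and
    \<open>k^2 \<le> k^3\<close>.\<close>
  also have "\<dots> \<le> 43 * (L^3 * k^3) + 9 * (L^2 * k^3)"
    using k L_pos power_increasing[of 2 3 k] unfolding K_def power_mult_distrib
    by (intro add_mono mult_left_mono) (auto simp: mult.commute[of "k^_"] intro!: mult_left_mono)
  finally show ?thesis by (simp add: algebra_simps)
qed

text \<open>From time \<open>\<Theta> / k\<close> on, \<open>rate\<close> is at most
  \<open>k / (2 * \<Theta>)\<close>, so the coefficient of \<open>k^3\<close> is small for large
  \<open>\<Theta>\<close>. This confines the maximum to times of order \<open>1/k\<close>.\<close>

lemma enstrophy_late:
  assumes \<Theta>: "0 < \<Theta>" and t: "\<Theta> / k \<le> t" and k: "2 * \<Theta> \<le> k" "1 \<le> k * L"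
  shows "enstrophy (u t) \<le> 16 / (3 * \<Theta>^3) * k^3 + 9 * L^2 * k^2"
proof -
  define r where "r = rate t"
  define K where "K = k * L"
  define N where "N = k / \<Theta>"
  have t0: "0 < t" using \<Theta> k_pos t by (smt (verit) divide_pos_pos)
  have r: "0 \<le> r" "r \<le> K" using rate_pos[of t] rate_le[of t] t0 by (auto simp: r_def K_def)
  have K: "1 \<le> K" using k by (simp add: K_def)
  have "r \<le> 1 / (2 * t)" using rate_le_inverse[OF t0] by (simp add: r_def)
  also have "\<dots> \<le> N / 2" using t \<Theta> k_pos t0 by (simp add: N_def field_simps)
  finally have rN: "2 * r + 2 \<le> 2 * N" using k \<Theta> by (simp add: N_def field_simps)
  have "enstrophy (u t) \<le> 2/3 * (2 * r + 2)^3 + r * (2 * r + 2) + (3 * r + 2) * K"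
    using enstrophy_le_rate[OF t0] by (simp add: r_def K_def)
  also have "\<dots> \<le> 2/3 * (2 * N)^3 + K * (4 * K) + (5 * K) * K"
    using r K rN by (intro add_mono mult_mono mult_left_mono power_mono) auto
  also have "\<dots> = 16 / (3 * \<Theta>^3) * k^3 + 9 * L^2 * k^2"
    by (simp add: power3_eq_cube power2_eq_square N_def K_def divide_simps)
  finally show ?thesis .
qed

text \<open>The height of the linear barrier is at most \<open>1 / (4 * t)\<close>, whatever the
  size of the data; after a large multiple of \<open>1/k\<close>, little of an energy of order
  \<open>k^2\<close> is left.\<close>

lemma energy_late:
  assumes t: "0 < t"
  shows "energy (u t) \<le> 1 / (32 * t^2)"
proof -
  have "energy (u t) \<le> integral {0..1/2} (\<lambda>x::real. (rate t / 2)^2)"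
    unfolding energy_eq[OF less_imp_le[OF t]]
  proof (rule integral_le)
    fix x assume x: "x \<in> {0..1/2::real}"
    have "- u t x \<le> rate t * (1/2 - x)" using linear_upper_bound[of t x] t x by auto
    also have "\<dots> \<le> rate t * (1/2)" using rate_pos[of t] t x by (intro mult_left_mono) auto
    finally have "- u t x \<le> rate t / 2" by simp
    then have "(- u t x)^2 \<le> (rate t / 2)^2" using u_nonpos[of t x] t x by (intro power_mono) auto
    then show "(u t x)^2 \<le> (rate t / 2)^2" by simp
  qed (use t in \<open>auto intro!: integrable_continuous_interval continuous_intros\<close>)
  also have "\<dots> = (rate t)^2 / 8" by (simp add: power_divide)
  also have "\<dots> \<le> (1 / (2 * t))^2 / 8"
    using rate_le_inverse[OF t] rate_pos[of t] t by (intro divide_right_mono power_mono) auto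
  finally show ?thesis by (simp add: power_divide power_mult_distrib)
qed

text \<open>The solution touches the layer barrier at \<open>0\<close>, so its slope there is at
  most that of a shock of height and inverse width of order \<open>k\<close>.\<close>

lemma ux_0_lower:
  assumes t: "0 < t" and k: "1 \<le> k * L"
  shows "- 16 * (k * L)^2 \<le> ux t 0"
proof -
  define c where "c = 2 * rate t + 2"
  have "- rate t + c^2 + ux t 0 \<ge> 0"
  proof (rule ccontr)
    assume "\<not> - rate t + c^2 + ux t 0 \<ge> 0"
    then have n: "- rate t + c^2 + ux t 0 < 0" by simp
    have "((\<lambda>x. - rate t * x + c * tanh (c * x) + u t x) has_real_derivative - rate t + c^2 + ux t 0) (at 0)"
      using t by (auto intro!: derivative_eq_intros simp: power2_eq_square)
    from DERIV_neg_dec_right[OF this n]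
    obtain e where e: "e > 0"
      "\<And>h. 0 < h \<Longrightarrow> h < e \<Longrightarrow> - rate t * h + c * tanh (c * h) + u t h < 0"
      using u_0[of t] t by auto
    define h where "h = min (e/2) (1/2)"
    have "0 < h" "h < e" "h \<le> 1/2" using e by (auto simp: h_def)
    then show False using e(2)[of h] tanh_layer_bound[of t h] t by (simp add: c_def)
  qed
  moreover have "c^2 \<le> (4 * (k * L))^2"
    unfolding c_def using rate_pos[of t] rate_le[of t] t k by (intro power_mono) auto
  ultimately show ?thesis using rate_pos[of t] t by (simp add: power_mult_distrib)
qed

text \<open>Convexity bounds the enstrophy by the maximum of \<open>- u\<close> times the increment of the slope; since
  \<open>- u\<close> decreases at most linearly to the right of its maximum, a large maximum forces a large energy.\<close>

lemma energy_lower: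
  assumes t: "0 < t" and k: "1 \<le> k * L"
  shows "(enstrophy (u t) / (17 * (k * L)^2))^3 / (3 * (k * L)) \<le> energy (u t)"
proof -
  define K where "K = k * L"
  have K: "1 \<le> K" using k by (simp add: K_def)
  obtain y where y: "0 \<le> y" "y \<le> 1/2" and mx: "\<And>x. 0 \<le> x \<Longrightarrow> x \<le> 1/2 \<Longrightarrow> - u t x \<le> - u t y"
    using continuous_attains_sup[of "{0..1/2::real}" "\<lambda>x. - u t x"] t
    by (auto simp: continuous_intros)
  define S where "S = - u t y"
  have S: "0 \<le> S" using u_nonpos[of t y] t y by (simp add: S_def)
  have "((\<lambda>x. S * uxx t x) has_integral S * ux t (1/2) - S * ux t 0) {0..1/2}"
    by (rule has_integral_of_DERIV[of "\<lambda>x. S * ux t x"]) (use t in \<open>auto intro!: derivative_eq_intros\<close>)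
  then have I: "integral {0..1/2} (\<lambda>x. S * uxx t x) = S * (ux t (1/2) - ux t 0)"
    by (metis integral_unique right_diff_distrib)
  have "enstrophy (u t) \<le> integral {0..1/2} (\<lambda>x. S * uxx t x)"
    unfolding enstrophy_by_parts[OF t]
    by (intro integral_le integrable_continuous_interval continuous_intros mult_right_mono)
      (use t mx uxx_nonneg[OF t] in \<open>auto simp: S_def\<close>)
  also have "integral {0..1/2} (\<lambda>x. S * uxx t x) = S * (ux t (1/2) - ux t 0)" by (rule I)
  also have "\<dots> \<le> S * (17 * K^2)"
  proof (intro mult_left_mono S)
    have "ux t (1/2) \<le> K" using ux_upper[OF t, of "1/2"] rate_le[of t] t by (simp add: K_def)
    moreover have "K \<le> K^2" using K by (simp add: power2_eq_square)
    ultimately show "ux t (1/2) - ux t 0 \<le> 17 * K^2" using ux_0_lower[OF t k] by (simp add: K_def)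
  qed
  finally have "enstrophy (u t) / (17 * K^2) \<le> S" using K by (simp add: pos_divide_le_eq)
  then have "(enstrophy (u t) / (17 * K^2))^3 \<le> S^3"
    using enstrophy_nonneg[of "u t"] K by (intro power_mono) auto
  also have "S^3 \<le> 3 * K * energy (u t)"
  proof -
    have "((\<lambda>x. 3 * (u t x)^2 * ux t x) has_integral (u t (1/2))^3 - (u t y)^3) {y..1/2}"
      by (rule has_integral_of_DERIV) (use t y in \<open>auto intro!: derivative_eq_intros\<close>)
    then have "S^3 = integral {y..1/2} (\<lambda>x. 3 * (u t x)^2 * ux t x)"
      using u_half[of t] t by (simp only: integral_unique) (simp add: S_def)
    also have "\<dots> \<le> integral {y..1/2} (\<lambda>x. 3 * K * (u t x)^2)"
    proof (rule integral_le)
      fix x assume x: "x \<in> {y..1/2}"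
      have "ux t x \<le> K" using ux_upper[OF t, of x] rate_le[of t] t x y by (simp add: K_def)
      then have "3 * (u t x)^2 * ux t x \<le> 3 * (u t x)^2 * K" by (intro mult_left_mono) auto
      then show "3 * (u t x)^2 * ux t x \<le> 3 * K * (u t x)^2" by (simp add: ac_simps)
    qed (use t in \<open>auto intro!: integrable_continuous_interval continuous_intros\<close>)
    also have "\<dots> \<le> integral {0..1/2} (\<lambda>x. 3 * K * (u t x)^2)"
      by (rule integral_subset_le) (use t y K in \<open>auto intro!: integrable_continuous_interval continuous_intros\<close>)
    also have "\<dots> = 3 * K * energy (u t)" using t by (simp add: energy_eq)
    finally show ?thesis .
  qed
  finally show ?thesis using K by (simp add: K_def[symmetric] pos_divide_le_eq ac_simps)
qed

end

subsection \<open>Comparison with the inviscid shock\<close>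

context odd_convex_profile begin

abbreviation solves where "solves k u ut ux uxx \<equiv> odd_convex_burgers f f1 f2 u ut ux uxx k"

text \<open>The intercept of the tangent line to \<open>- f\<close> at \<open>x\<close>.\<close>

definition \<beta> :: "real \<Rightarrow> real" where "\<beta> x = - f x + x * f1 x"

text \<open>At time \<open>\<theta> x / k\<close> the inviscid characteristic starting from \<open>x\<close> enters the shock at \<open>0\<close>,
  whose half-height is then \<open>- k f x\<close>.\<close>

definition \<theta> :: "real \<Rightarrow> real" where "\<theta> x = x / (- 2 * f x)"

text \<open>The energy at time \<open>\<theta> x / k\<close> of the inviscid solution, divided by \<open>k\<^sup>2\<close>.\<close>

definition V :: "real \<Rightarrow> real" where
  "V x = integral {0..1/2} (\<lambda>y. (f y)^2) - integral {0..x} (\<lambda>y. (f y)^2) + x * (f x)^2 / 3"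

section \<open>The inviscid solution in terms of the starting point of characteristics\<close>

lemma DERIV_\<beta>: "(\<beta> has_real_derivative x * f2 x) (at x)"
  unfolding \<beta>_def by (auto intro!: derivative_eq_intros)

lemma \<beta>_mono: assumes "0 \<le> x" "x \<le> y" "y \<le> 1/2" shows "\<beta> x \<le> \<beta> y"
proof (rule DERIV_nonneg_imp_nondecreasing[OF assms(2)])
  fix z assume "x \<le> z" "z \<le> y"
  then have "0 \<le> z * f2 z" using assms f2_nonneg[of z] by simp
  then show "\<exists>d. (\<beta> has_real_derivative d) (at z) \<and> 0 \<le> d" using DERIV_\<beta> by blast
qed

lemma f_bound: assumes "0 \<le> x" "x \<le> 1/2" shows "- f x \<le> L / 2"
proof -
  have "- f x \<le> L * x" using assms by (rule f_le_linear)
  also have "\<dots> \<le> L * (1/2)" using assms L_pos by (intro mult_left_mono) auto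
  finally show ?thesis by simp
qed

lemma \<beta>_le: assumes "0 \<le> x" "x \<le> 1/2" shows "\<beta> x \<le> L"
proof -
  have "x * f1 x \<le> x * L" using assms f1_bound[of x] by (intro mult_left_mono) auto
  also have "\<dots> \<le> (1/2) * L" using assms L_pos by (intro mult_right_mono) auto
  finally have "x * f1 x \<le> (1/2) * L" .
  then show ?thesis using f_bound[OF assms] by (simp add: \<beta>_def)
qed

lemma \<beta>_nonneg: assumes "0 \<le> x" "x \<le> 1/2" shows "0 \<le> \<beta> x"
  using \<beta>_mono[of 0 x] assms by (simp add: \<beta>_def f_0)

lemma \<theta>_pos: "0 < x \<Longrightarrow> x < 1/2 \<Longrightarrow> 0 < \<theta> x"
  using f_neg[of x] unfolding \<theta>_def by (intro divide_pos_pos) auto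

lemma DERIV_\<theta>: assumes "0 < x" "x < 1/2" shows "(\<theta> has_real_derivative \<beta> x / (2 * (f x)^2)) (at x)"
proof -
  have "(\<theta> has_real_derivative (1 * (- 2 * f x) - x * (- 2 * f1 x)) / ((- 2 * f x) * (- 2 * f x))) (at x)"
    unfolding \<theta>_def using f_neg[OF assms] by (intro DERIV_divide DERIV_ident DERIV_cmult df) auto
  also have "(1 * (- 2 * f x) - x * (- 2 * f1 x)) / ((- 2 * f x) * (- 2 * f x)) = \<beta> x / (2 * (f x)^2)"
    using f_neg[OF assms] by (simp add: \<beta>_def divide_simps power2_eq_square)
  finally show ?thesis .
qed

lemma \<theta>_mono: assumes "0 < x" "x \<le> y" "y < 1/2" shows "\<theta> x \<le> \<theta> y"
proof (rule DERIV_nonneg_imp_nondecreasing[OF assms(2)])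
  fix z assume "x \<le> z" "z \<le> y"
  then have "(\<theta> has_real_derivative \<beta> z / (2 * (f z)^2)) (at z)" "0 \<le> \<beta> z / (2 * (f z)^2)"
    using assms DERIV_\<theta>[of z] \<beta>_nonneg[of z] by auto
  then show "\<exists>d. (\<theta> has_real_derivative d) (at z) \<and> 0 \<le> d" by blast
qed

text \<open>This is the inviscid energy law: the right side equals
  \<open>- 2 * (2/3 * (- f x)^3)\<close> times the derivative of \<open>\<theta>\<close> at
  \<open>x\<close>.\<close>

lemma DERIV_V: assumes "0 < x" "x < 1/2" shows "(V has_real_derivative 2/3 * f x * \<beta> x) (at x)"
proof -
  have "((\<lambda>x. integral {0..x} (\<lambda>y. (f y)^2)) has_real_derivative (f x)^2) (at x within {0..1/2})"
    by (rule integral_has_real_derivative) (use assms in \<open>auto intro!: continuous_intros\<close>)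
  then have d: "((\<lambda>x. integral {0..x} (\<lambda>y. (f y)^2)) has_real_derivative (f x)^2) (at x)"
    using at_within_Icc_at[of 0 x "1/2"] assms by simp
  have "(V has_real_derivative 0 - (f x)^2 + (x * (2 * f x * f1 x) + 1 * (f x)^2) / 3) (at x)"
    unfolding V_def by (auto intro!: derivative_eq_intros d)
  also have "0 - (f x)^2 + (x * (2 * f x * f1 x) + 1 * (f x)^2) / 3 = 2/3 * f x * \<beta> x"
    by (simp add: \<beta>_def power2_eq_square algebra_simps)
  finally show ?thesis .
qed

lemma V_nonneg: assumes "0 \<le> x" "x \<le> 1/2" shows "0 \<le> V x"
proof -
  have "integral {0..x} (\<lambda>y. (f y)^2) \<le> integral {0..1/2} (\<lambda>y. (f y)^2)"
    by (rule integral_subset_le) (use assms in \<open>auto intro!: integrable_continuous_interval continuous_intros\<close>)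
  moreover have "0 \<le> x * (f x)^2 / 3" using assms by simp
  ultimately show ?thesis by (simp add: V_def)
qed

lemma V_mono: assumes "0 \<le> x" "x \<le> y" "y < 1/2" shows "V y \<le> V x"
proof -
  have "- V x \<le> - V y"
  proof (rule DERIV_nonneg_imp_increasing_open[OF assms(2), of "\<lambda>x. - V x"])
    fix z assume z: "x < z" "z < y"
    have "f z * \<beta> z \<le> 0" using f_nonpos[of z] \<beta>_nonneg[of z] z assms by (intro mult_nonpos_nonneg) auto
    moreover have "((\<lambda>x. - V x) has_real_derivative - (2/3 * f z * \<beta> z)) (at z)"
      using DERIV_V[of z] z assms by (intro DERIV_minus) auto
    ultimately show "\<exists>d. ((\<lambda>x. - V x) has_real_derivative d) (at z) \<and> 0 \<le> d"
      by (intro exI[of _ "- (2/3 * f z * \<beta> z)"]) simp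
  next
    have "continuous_on {0..1/2} (\<lambda>x. integral {0..x} (\<lambda>y. (f y)^2))"
      by (intro indefinite_integral_continuous_1 integrable_continuous_interval continuous_intros)
    then have "continuous_on {x..y} (\<lambda>x. integral {0..x} (\<lambda>y. (f y)^2))"
      by (rule continuous_on_subset) (use assms in auto)
    then show "continuous_on {x..y} (\<lambda>x. - V x)" unfolding V_def by (intro continuous_intros) auto
  qed
  then show ?thesis by simp
qed

lemma energy_init: assumes "solves k u ut ux uxx" shows "energy (u 0) = k^2 * V 0"
proof -
  interpret odd_convex_burgers f f1 f2 u ut ux uxx k by fact
  show ?thesis by (simp add: energy_eq init V_def power_mult_distrib)
qed

lemma tangent_line: assumes "0 \<le> x" "x \<le> 1/2" "0 \<le> s" "s \<le> 1/2" shows "- f s \<le> - f1 x * s + \<beta> x"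
  using f_tangent[OF assms] by (simp add: \<beta>_def algebra_simps)

text \<open>The factor by which the tangent line at \<open>x\<close> is compressed when its point of
  contact reaches \<open>0\<close>. Dividing the intercept \<open>\<beta> x\<close> by it gives
  \<open>- f x\<close>, the half-height of the inviscid shock.\<close>

lemma tangent_dilation: assumes "0 < x" "x < 1/2" shows "1 - 2 * (- f1 x) * \<theta> x = \<beta> x / (- f x)"
  using f_neg[OF assms] by (simp add: \<theta>_def \<beta>_def field_simps)

text \<open>The tangent line at \<open>x\<close> is sharp at \<open>s = \<theta> x\<close>. If
  \<open>f1 x \<le> 0\<close>, it only steepens with time, its intercept is largest at the end, and
  the bound also holds for all earlier \<open>s\<close>. The auxiliary constants depend on
  \<open>xa\<close> and \<open>xb\<close> alone, so the threshold for \<open>k\<close> is uniform in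
  \<open>x\<close>.\<close>

lemma enstrophy_shock_bound:
  assumes x: "0 < xa" "xa \<le> xb" "xb < 1/2" and \<beta>: "0 < \<beta> xa" and \<epsilon>: "0 < \<epsilon>"
  shows "\<forall>\<^sub>F k in at_top. \<forall>u ut ux uxx. solves k u ut ux uxx \<longrightarrow>
    (\<forall>x\<in>{xa..xb}. \<forall>s\<in>{0<..\<theta> x}. s = \<theta> x \<or> f1 x \<le> 0 \<longrightarrow> enstrophy (u (s / k)) \<le> k^3 * (2/3 * (- f x)^3 + \<epsilon>))"
proof -
  obtain y where y: "y \<in> {xa..xb}" "\<And>x. x \<in> {xa..xb} \<Longrightarrow> - f y \<le> - f x"
    using continuous_attains_inf[of "{xa..xb}" "\<lambda>x. - f x"] x by (auto simp: continuous_intros)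
  have fy: "0 < - f y" using f_neg[of y] y x by auto
  define A where "A = L + 1"
  define \<rho> where "\<rho> = min 1 (\<beta> xa / L)"
  define D where "D = max 1 (L / (- f y))"
  \<comment> \<open>\<open>\<delta>\<close> is the error allowed in the half-height: the last entry
    keeps the increase of the cube below \<open>\<epsilon> / 2\<close>. The surplus intercept
    \<open>e\<close> becomes at most \<open>\<delta>\<close> after division by the compression
    factor; the entry \<open>L / \<beta> xa\<close> ensures \<open>e \<le> 1\<close>.\<close>
  define \<delta> where "\<delta> = Min {1, L / \<beta> xa, \<epsilon> / (2 * (3 * L^2 + 3 * L + 1))}"
  define e where "e = \<delta> * \<beta> xa / L"
  define C where "C = 2 * A^2 / \<rho>^2 + 3 * A * L / \<rho>"
  have \<delta>: "0 < \<delta>" "\<delta> \<le> 1" "\<delta> \<le> L / \<beta> xa" "\<delta> \<le> \<epsilon> / (2 * (3 * L^2 + 3 * L + 1))"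
    using L_pos \<beta> \<epsilon> by (auto simp: \<delta>_def intro!: divide_pos_pos add_nonneg_pos)
  have e: "0 < e" "e \<le> 1" using \<delta> L_pos \<beta> by (auto simp: e_def field_simps)
  have \<rho>: "0 < \<rho>" "\<rho> \<le> 1" "\<rho> \<le> \<beta> xa / L" using \<beta> L_pos by (auto simp: \<rho>_def)
  show ?thesis
    using eventually_ge_at_top[of "2 * A * D / e^2 + (L + A) * (1 + A / e) / e^2"]
      eventually_ge_at_top[of "2 * C / \<epsilon>"] eventually_gt_at_top[of 0]
  proof eventually_elim
    case (elim k)
    show ?case
    proof (intro allI impI ballI)
      fix u ut ux uxx x s
      assume "solves k u ut ux uxx" and xx: "x \<in> {xa..xb}" and s: "s \<in> {0<..\<theta> x}" and or: "s = \<theta> x \<or> f1 x \<le> 0"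
      interpret odd_convex_burgers f f1 f2 u ut ux uxx k by fact
      have x': "0 < x" "x < 1/2" using xx x by auto
      define g where "g = - f x"
      have g: "0 < g" "g \<le> L" "- f y \<le> g" using f_neg[OF x'] f_bound[of x] y(2)[OF xx] x' L_pos by (auto simp: g_def)
      have b: "\<beta> xa \<le> \<beta> x" "\<beta> x \<le> L" using \<beta>_mono[of xa x] \<beta>_le[of x] xx x by auto
      have lo: "\<beta> x / g \<le> 1 - 2 * (- f1 x) * s"
      proof (cases "s = \<theta> x")
        case True then show ?thesis using tangent_dilation[OF x'] by (simp add: g_def)
      next
        case False
        then have "(- f1 x) * s \<le> (- f1 x) * \<theta> x" using or s by (intro mult_left_mono) auto
        then show ?thesis using tangent_dilation[OF x'] by (simp add: g_def)
      qed
      have hi: "1 - 2 * (- f1 x) * s \<le> D"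
      proof (cases "s = \<theta> x")
        case True
        have "\<beta> x / g \<le> L / (- f y)" using b g fy \<beta> by (intro frac_le) auto
        then show ?thesis using tangent_dilation[OF x'] True by (simp add: g_def D_def)
      next
        case False
        then have "f1 x * s \<le> 0" using or s by (intro mult_nonpos_nonneg) auto
        then show ?thesis by (simp add: D_def)
      qed
      have "\<beta> xa / L \<le> \<beta> x / g" using b g \<beta> by (intro frac_le) auto
      then have lo2: "\<rho> \<le> 1 - 2 * (- f1 x) * s" using \<rho> lo by linarith
      have E: "enstrophy (u (s / k)) \<le> k^3 * (2/3 * ((\<beta> x + e) / (1 - 2 * (- f1 x) * s))^3) + k^2 * C"
        unfolding C_def
      proof (rule enstrophy_le_line)
        show "- f s \<le> - f1 x * s + \<beta> x" if "0 \<le> s" "s \<le> 1/2" for s using tangent_line[of x s] x' that by auto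
        show "1 \<le> D" by (simp add: D_def)
        show "\<bar>- f1 x\<bar> \<le> A" using f1_bound[of x] by (simp add: A_def)
        show "1 \<le> A" "\<beta> x \<le> A" "0 \<le> \<beta> x" using L_pos b \<beta> by (auto simp: A_def)
        show "0 < s" using s by simp
      qed (rule \<rho>(1) \<rho>(2) lo2 hi e elim(1))+
      define X where "X = (\<beta> x + e) / (1 - 2 * (- f1 x) * s)"
      have \<beta>x: "0 < \<beta> x" using b \<beta> by linarith
      have bg: "0 < \<beta> x / g" using \<beta>x g by simp
      have pos: "0 < 1 - 2 * (- f1 x) * s" using lo bg by linarith
      have "X \<le> (\<beta> x + e) / (\<beta> x / g)"
        unfolding X_def using lo \<beta>x e bg pos by (intro divide_left_mono mult_pos_pos) linarith+
      also have "\<dots> = g + g * e / \<beta> x" using \<beta>x by (simp add: field_simps)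
      also have "g * e / \<beta> x \<le> L * e / \<beta> xa" using b \<beta> e g by (intro frac_le mult_right_mono) auto
      also have "L * e / \<beta> xa = \<delta>" using L_pos \<beta> by (simp add: e_def)
      finally have X: "X \<le> g + \<delta>" by simp
      have "0 \<le> X" unfolding X_def using pos \<beta>x e by (intro divide_nonneg_pos) linarith+
      with X have "X^3 \<le> (g + \<delta>)^3" by (intro power_mono)
      also have "\<dots> = g^3 + \<delta> * (3 * g^2 + 3 * g * \<delta> + \<delta>^2)" by (simp add: power2_eq_square power3_eq_cube algebra_simps)
      also have "\<delta> * (3 * g^2 + 3 * g * \<delta> + \<delta>^2) \<le> \<epsilon> / (2 * (3 * L^2 + 3 * L + 1)) * (3 * L^2 + 3 * L * 1 + 1)"
        using \<delta> g \<epsilon> L_pos by (intro mult_mono add_mono mult_left_mono power_mono power_le_one) auto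
      also have "\<dots> = \<epsilon> / 2"
      proof -
        have "0 < 3 * L^2 + 3 * L + 1" using L_pos by (intro add_nonneg_pos) auto
        then have "3 * L^2 + 3 * L * 1 + 1 \<noteq> 0" by simp
        then show ?thesis by (simp add: divide_simps)
      qed
      finally have "X^3 \<le> g^3 + \<epsilon> / 2" by simp
      then have "k^3 * (2/3 * X^3) \<le> k^3 * (2/3 * g^3 + \<epsilon> / 2)" using k_pos \<epsilon> by (intro mult_left_mono) auto
      moreover have "k^2 * C \<le> k^3 * (\<epsilon> / 2)"
      proof -
        have "C \<le> k * (\<epsilon> / 2)" using elim(2) \<epsilon> by (simp add: pos_divide_le_eq)
        then have "k^2 * C \<le> k^2 * (k * (\<epsilon> / 2))" by (intro mult_left_mono) auto
        then show ?thesis by (simp add: power2_eq_square power3_eq_cube)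
      qed
      ultimately show "enstrophy (u (s / k)) \<le> k^3 * (2/3 * (- f x)^3 + \<epsilon>)"
        using E unfolding X_def[symmetric] g_def[symmetric] by (simp add: algebra_simps)
    qed
  qed
qed

text \<open>Time is parametrised by \<open>x\<close>, through \<open>t = \<theta> x / k\<close>.
  Then twice the sharp enstrophy bound is, up to the error, \<open>- k^2\<close> times the
  derivative of \<open>V\<close>, so the viscous energy decreases no faster than the inviscid
  one.\<close>

lemma energy_shock_loss:
  assumes x: "0 < xa" "xa \<le> xb" "xb < 1/2" and \<beta>: "0 < \<beta> xa" and \<epsilon>: "0 < \<epsilon>"
  shows "\<forall>\<^sub>F k in at_top. \<forall>u ut ux uxx. solves k u ut ux uxx \<longrightarrow>
    energy (u (\<theta> xa / k)) - energy (u (\<theta> xb / k)) \<le> k^2 * (V xa - V xb + \<epsilon>)"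
proof -
  define \<epsilon>' where "\<epsilon>' = \<epsilon> / (2 * (\<theta> xb - \<theta> xa) + 1)"
  have den: "0 < 2 * (\<theta> xb - \<theta> xa) + 1" using \<theta>_mono[OF x] by simp
  have \<epsilon>': "0 < \<epsilon>'" using \<epsilon> den by (simp add: \<epsilon>'_def)
  have "2 * \<epsilon>' * (\<theta> xb - \<theta> xa) \<le> \<epsilon>' * (2 * (\<theta> xb - \<theta> xa) + 1)" using \<epsilon>' by (simp add: algebra_simps)
  also have "\<dots> = \<epsilon>" using den by (simp add: \<epsilon>'_def)
  finally have sm: "2 * \<epsilon>' * (\<theta> xb - \<theta> xa) \<le> \<epsilon>" .
  show ?thesis
    using enstrophy_shock_bound[OF x \<beta> \<epsilon>'] eventually_gt_at_top[of 0]
  proof eventually_elim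
    case (elim k)
    show ?case
    proof (intro allI impI)
      fix u ut ux uxx assume sol: "solves k u ut ux uxx"
      interpret odd_convex_burgers f f1 f2 u ut ux uxx k by fact
      define H where "H = (\<lambda>x. energy (u (\<theta> x / k)) - k^2 * (V x - 2 * \<epsilon>' * \<theta> x))"
      have "H xa \<le> H xb"
      proof (rule DERIV_nonneg_imp_nondecreasing[OF x(2)])
        fix z assume z: "xa \<le> z" "z \<le> xb"
        then have z': "0 < z" "z < 1/2" using x by auto
        define \<theta>' where "\<theta>' = \<beta> z / (2 * (f z)^2)"
        have \<theta>': "0 \<le> \<theta>'" using \<beta>_nonneg[of z] z' by (simp add: \<theta>'_def)
        have fb: "2/3 * f z * \<beta> z = - 4/3 * (- f z)^3 * \<theta>'"
          using f_neg[OF z'] by (simp add: \<theta>'_def field_simps power2_eq_square power3_eq_cube)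
        have "((\<lambda>x. energy (u (\<theta> x / k))) has_real_derivative - 2 * enstrophy (u (\<theta> z / k)) * (\<theta>' / k)) (at z)"
        proof (rule DERIV_chain2[OF DERIV_energy])
          show "0 < \<theta> z / k" using \<theta>_pos[OF z'] k_pos by simp
          show "((\<lambda>x. \<theta> x / k) has_real_derivative \<theta>' / k) (at z)"
            unfolding \<theta>'_def by (intro DERIV_cdivide DERIV_\<theta> z')
        qed
        then have "(H has_real_derivative - 2 * enstrophy (u (\<theta> z / k)) * (\<theta>' / k)
            - k^2 * (2/3 * f z * \<beta> z - 2 * \<epsilon>' * \<theta>')) (at z)"
          unfolding H_def \<theta>'_def by (auto intro!: derivative_eq_intros DERIV_\<theta> DERIV_V z')
        moreover have "0 \<le> - 2 * enstrophy (u (\<theta> z / k)) * (\<theta>' / k) - k^2 * (2/3 * f z * \<beta> z - 2 * \<epsilon>' * \<theta>')"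
        proof -
          have "enstrophy (u (\<theta> z / k)) \<le> k^3 * (2/3 * (- f z)^3 + \<epsilon>')"
            using elim(1)[rule_format, OF sol, of z "\<theta> z"] z \<theta>_pos[OF z'] by simp
          then have "enstrophy (u (\<theta> z / k)) * (2 * \<theta>' / k) \<le> k^3 * (2/3 * (- f z)^3 + \<epsilon>') * (2 * \<theta>' / k)"
            using \<theta>' k_pos by (intro mult_right_mono) auto
          also have "\<dots> = k^2 * (4/3 * (- f z)^3 * \<theta>' + 2 * \<epsilon>' * \<theta>')"
            using k_pos by (simp add: field_simps power2_eq_square power3_eq_cube)
          finally show ?thesis unfolding fb by (simp add: algebra_simps)
        qed
        ultimately show "\<exists>y. (H has_real_derivative y) (at z) \<and> 0 \<le> y" by blast
      qed
      then have "energy (u (\<theta> xa / k)) - energy (u (\<theta> xb / k)) \<le> k^2 * (V xa - V xb + 2 * \<epsilon>' * (\<theta> xb - \<theta> xa))"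
        by (simp add: H_def algebra_simps)
      also have "\<dots> \<le> k^2 * (V xa - V xb + \<epsilon>)" using sm by (intro mult_left_mono add_left_mono) auto
      finally show "energy (u (\<theta> xa / k)) - energy (u (\<theta> xb / k)) \<le> k^2 * (V xa - V xb + \<epsilon>)" .
    qed
  qed
qed

text \<open>Since \<open>f\<close> vanishes at \<open>1/2\<close> with bounded slope,
  \<open>\<theta>\<close> tends to infinity there, and the decay of the energy applies. With
  \<open>h = 1/2 - xb\<close> the remainder is at most \<open>2 * L^2 * h^2 * k^2\<close>.\<close>

lemma energy_tail:
  assumes x: "x0 < 1/2" and \<epsilon>: "0 < \<epsilon>"
  obtains xb where "x0 \<le> xb" "1/4 \<le> xb" "xb < 1/2"
    "\<forall>k u ut ux uxx. solves k u ut ux uxx \<longrightarrow> energy (u (\<theta> xb / k)) \<le> k^2 * \<epsilon>"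
proof -
  have "0 < \<epsilon> / L^2" using \<epsilon> L_pos by simp
  define h where "h = min (1/2 - x0) (min (1/4) (\<epsilon> / L^2))"
  have h: "0 < h" "h \<le> 1/2 - x0" "h \<le> 1/4" "h \<le> \<epsilon> / L^2"
    using x \<open>0 < \<epsilon> / L^2\<close> unfolding h_def by linarith+
  define xb where "xb = 1/2 - h"
  have xb: "1/4 \<le> xb" "xb < 1/2" using h by (auto simp: xb_def)
  have "- f xb \<le> L * h" using f_lipschitz[of xb "1/2"] f_half xb by (simp add: xb_def)
  then have "(1/4) / (2 * (L * h)) \<le> xb / (2 * (- f xb))"
    using xb h L_pos f_neg[of xb] by (intro frac_le) (auto simp: mult.commute)
  then have \<theta>: "1 / (8 * L * h) \<le> \<theta> xb" by (simp add: \<theta>_def)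
  have "energy (u (\<theta> xb / k)) \<le> k^2 * \<epsilon>" if "solves k u ut ux uxx" for k u ut ux uxx
  proof -
    from that interpret odd_convex_burgers f f1 f2 u ut ux uxx k .
    have "energy (u (\<theta> xb / k)) \<le> 1 / (32 * (\<theta> xb / k)^2)"
      using \<theta>_pos[of xb] xb k_pos by (intro energy_late) auto
    also have "\<dots> = k^2 / 32 * (1 / (\<theta> xb)^2)" using k_pos by (simp add: power_divide)
    also have "\<dots> \<le> k^2 / 32 * (1 / (1 / (8 * L * h))^2)"
      using \<theta> h L_pos by (intro mult_left_mono divide_left_mono power_mono mult_pos_pos zero_less_power) (auto intro: less_le_trans[OF _ \<theta>])
    also have "\<dots> = k^2 * (2 * L^2 * h * h)" by (simp add: power_divide power2_eq_square)
    also have "\<dots> \<le> k^2 * (2 * L^2 * (1/4) * (\<epsilon> / L^2))"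
      using h by (intro mult_left_mono mult_mono) auto
    also have "\<dots> \<le> k^2 * \<epsilon>" using L_pos \<epsilon> by (intro mult_left_mono) auto
    finally show ?thesis .
  qed
  then show thesis using that[of xb] xb h(2) by (simp add: xb_def)
qed

text \<open>Near the left end of the region where \<open>\<beta>\<close> is positive the transported tangent line alone shows
  that little energy is lost before the characteristics of that region reach \<open>0\<close>.\<close>

lemma early_energy_loss:
  assumes x: "0 < x1" "x1 < 1/2" and \<beta>: "0 < \<beta> x1" and f1: "f1 x1 < 0" and \<delta>: "0 < \<delta>"
  obtains xa where "0 < xa" "xa \<le> x1" "0 < \<beta> xa"
    "\<forall>\<^sub>F k in at_top. \<forall>u ut ux uxx. solves k u ut ux uxx \<longrightarrow> energy (u 0) - energy (u (\<theta> xa / k)) \<le> k^2 * \<delta>"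
proof -
  \<comment> \<open>The leading loss is \<open>8 * \<eta> * g^2 / (3 * \<alpha>) * k^2\<close>,
    where \<open>g \<le> L\<close> and \<open>\<alpha> \<ge> - f1 x1\<close>; the last entry makes
    it at most half of \<open>\<delta> * k^2\<close>.\<close>
  define \<eta> where "\<eta> = Min {\<beta> x1, 1, 3 * \<delta> * (- f1 x1) / (16 * L^2)}"
  have \<eta>: "0 < \<eta>" "\<eta> \<le> \<beta> x1" "\<eta> \<le> 1" "\<eta> \<le> 3 * \<delta> * (- f1 x1) / (16 * L^2)"
    using \<beta> f1 \<delta> L_pos by (auto simp: \<eta>_def intro!: divide_neg_pos mult_pos_neg)
  have "\<exists>xa. 0 \<le> xa \<and> xa \<le> x1 \<and> \<beta> xa = \<eta>"
    by (rule IVT') (use x \<eta> f_0 in \<open>auto simp: \<beta>_def intro!: continuous_intros\<close>)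
  then obtain xa where xa0: "0 \<le> xa" "xa \<le> x1" "\<beta> xa = \<eta>" by blast
  have "xa \<noteq> 0" using xa0 \<eta> f_0 by (auto simp: \<beta>_def)
  then have xa: "0 < xa" "xa < 1/2" using xa0 x by auto
  define \<alpha> where "\<alpha> = - f1 xa"
  define g where "g = - f xa"
  have \<alpha>: "- f1 x1 \<le> \<alpha>" "0 < \<alpha>" using f1_mono[of xa x1] xa0 x f1 by (auto simp: \<alpha>_def)
  have g: "0 < g" "g \<le> L" using f_neg[OF xa] f_bound[of xa] xa L_pos by (auto simp: g_def)
  have dil: "1 - 2 * \<alpha> * \<theta> xa = \<eta> / g" using tangent_dilation[OF xa] xa0 by (simp add: \<alpha>_def g_def)
  define A where "A = L + 1"
  define \<rho> where "\<rho> = min 1 (\<eta> / g)"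
  define C where "C = 2 * A^2 / \<rho>^2 + 3 * A * L / \<rho>"
  have \<rho>: "0 < \<rho>" using \<eta> g by (simp add: \<rho>_def)
  show thesis
  proof (rule that[of xa])
    show "\<forall>\<^sub>F k in at_top. \<forall>u ut ux uxx. solves k u ut ux uxx \<longrightarrow> energy (u 0) - energy (u (\<theta> xa / k)) \<le> k^2 * \<delta>"
      using eventually_ge_at_top[of "2 * A * 1 / \<eta>^2 + (L + A) * (1 + A / \<eta>) / \<eta>^2"]
        eventually_ge_at_top[of "4 * C * \<theta> xa / \<delta>"] eventually_gt_at_top[of 0]
    proof eventually_elim
      case (elim k)
      show ?case
      proof (intro allI impI)
        fix u ut ux uxx assume "solves k u ut ux uxx"
        interpret odd_convex_burgers f f1 f2 u ut ux uxx k by fact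
        define T where "T = \<theta> xa / k"
        have T: "0 < T" "k * T = \<theta> xa" using \<theta>_pos[OF xa] k_pos by (auto simp: T_def)
        define d where "d = (\<lambda>t. 1 - 2 * \<alpha> * (k * t))"
        have d: "\<rho> \<le> d t" "d t \<le> 1" "0 < d t" if "0 \<le> t" "t \<le> T" for t
        proof -
          have "k * t \<le> \<theta> xa" using mult_left_mono[OF that(2), of k] T k_pos by simp
          then have "\<alpha> * (k * t) \<le> \<alpha> * \<theta> xa" using \<alpha> by (intro mult_left_mono) auto
          then show "\<rho> \<le> d t" using dil by (simp add: d_def \<rho>_def)
          then show "0 < d t" using \<rho> by linarith
          show "d t \<le> 1" using \<alpha> k_pos that by (simp add: d_def)
        qed
        \<comment> \<open>Since \<open>d' = - 2 * \<alpha> * k\<close>, the derivative of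
          \<open>k^2 * c / (d t)^2\<close> is exactly twice the leading barrier enstrophy, with
          intercept and surplus both equal to \<open>\<eta>\<close>.\<close>
        define c where "c = (2 * \<eta>)^3 / (3 * \<alpha>)"
        define H where "H = (\<lambda>t. energy (u t) + k^2 * c * (1 / (d t)^2) + 2 * C * k^2 * t)"
        have H0T: "H 0 \<le> H T"
        proof (rule DERIV_nonneg_imp_increasing_open[of 0 T H])
          have "continuous_on {0..T} d" unfolding d_def by (intro continuous_intros)
          moreover have "continuous_on {0..T} (\<lambda>t. energy (u t))"
            by (rule continuous_on_subset[OF continuous_on_energy]) auto
          moreover have "\<forall>t\<in>{0..T}. (d t)^2 \<noteq> 0" using d(3) by fastforce
          ultimately show "continuous_on {0..T} H"
            unfolding H_def by (intro continuous_intros)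
        next
          fix t assume t: "0 < t" "t < T"
          have dp: "0 < d t" using d t by auto
          have dd: "(d has_real_derivative - 2 * \<alpha> * k) (at t)"
            unfolding d_def by (auto intro!: derivative_eq_intros)
          have d2: "((\<lambda>t. 1 / (d t)^2) has_real_derivative 4 * \<alpha> * k / (d t)^3) (at t)"
            by (rule DERIV_cong[OF DERIV_divide[OF DERIV_const DERIV_power[OF dd, of 2]]])
              (use dp in \<open>auto simp: divide_simps power2_eq_square power3_eq_cube\<close>)
          have HD: "(H has_real_derivative - 2 * enstrophy (u t) + k^2 * c * (4 * \<alpha> * k / (d t)^3) + 2 * C * k^2 * 1) (at t)"
            unfolding H_def by (intro DERIV_add DERIV_energy DERIV_cmult d2 DERIV_ident t)
          have EB: "enstrophy (u ((k * t) / k)) \<le> k^3 * (2/3 * ((\<eta> + \<eta>) / (1 - 2 * \<alpha> * (k * t)))^3) + k^2 * (2 * A^2 / \<rho>^2 + 3 * A * L / \<rho>)"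
          proof (rule enstrophy_le_line[where D = 1])
            show "- f s \<le> \<alpha> * s + \<eta>" if "0 \<le> s" "s \<le> 1/2" for s
              using tangent_line[of xa s] xa that xa0 by (auto simp: \<alpha>_def)
            show "\<bar>\<alpha>\<bar> \<le> A" using f1_bound[of xa] by (simp add: A_def \<alpha>_def)
            show "\<rho> \<le> 1 - 2 * \<alpha> * (k * t)" "1 - 2 * \<alpha> * (k * t) \<le> 1" using d[of t] t by (auto simp: d_def)
          qed (use \<eta> L_pos \<rho> t k_pos elim xa xa0 \<beta>_le[of xa] in \<open>auto simp: A_def \<rho>_def\<close>)
          have CC: "k^2 * c * (4 * \<alpha> * k / (d t)^3) = 2 * (k^3 * (2/3 * ((\<eta> + \<eta>) / d t)^3))"
            using \<alpha> dp by (simp add: c_def power_divide field_simps power2_eq_square power3_eq_cube)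
          have "enstrophy (u t) \<le> k^3 * (2/3 * ((\<eta> + \<eta>) / d t)^3) + k^2 * C"
            using EB k_pos by (simp add: C_def d_def)
          then have "0 \<le> - 2 * enstrophy (u t) + k^2 * c * (4 * \<alpha> * k / (d t)^3) + 2 * C * k^2 * 1"
            unfolding CC by (simp only: mult_1_right mult.commute[of "k^2" C])
          with HD show "\<exists>y. (H has_real_derivative y) (at t) \<and> 0 \<le> y" by blast
        qed (use T in auto)
        have c2: "0 \<le> k^2 * c" using \<alpha> \<eta> by (simp add: c_def)
        have "c * (1 / (d T)^2) \<le> \<delta> / 2"
        proof -
          have dT: "d T = \<eta> / g" using dil T by (simp add: d_def)
          have "c * (1 / (d T)^2) = \<eta> * (8 * g^2 / (3 * \<alpha>))"
            unfolding dT using \<eta> g \<alpha> by (simp add: c_def power_divide field_simps power2_eq_square power3_eq_cube)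
          also have "\<dots> \<le> (3 * \<delta> * (- f1 x1) / (16 * L^2)) * (8 * L^2 / (3 * (- f1 x1)))"
          proof (rule mult_mono[OF \<eta>(4)])
            have "g^2 \<le> L^2" using g by (intro power_mono) auto
            then show "8 * g^2 / (3 * \<alpha>) \<le> 8 * L^2 / (3 * (- f1 x1))" using \<alpha> f1 by (intro frac_le) auto
            show "0 \<le> 3 * \<delta> * (- f1 x1) / (16 * L^2)" using \<eta> by linarith
            show "0 \<le> 8 * g^2 / (3 * \<alpha>)" using \<alpha> by simp
          qed
          also have "\<dots> = \<delta> / 2" using f1 L_pos by (simp add: field_simps)
          finally show ?thesis .
        qed
        then have cd: "k^2 * (c * (1 / (d T)^2)) \<le> k^2 * (\<delta> / 2)" by (intro mult_left_mono) auto
        have CT: "2 * C * k^2 * T \<le> k^2 * (\<delta> / 2)"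
        proof -
          have "4 * C * (k * T) \<le> k * \<delta>" using elim(2) \<delta> T by (simp add: pos_divide_le_eq)
          then have "k * (4 * C * (k * T)) \<le> k * (k * \<delta>)" using k_pos by (intro mult_left_mono) auto
          then show ?thesis by (simp add: power2_eq_square algebra_simps)
        qed
        have "energy (u 0) - energy (u T) \<le> k^2 * \<delta>"
        proof -
          have "H 0 = energy (u 0) + k^2 * c" by (simp add: H_def d_def)
          moreover have "H T = energy (u T) + k^2 * (c * (1 / (d T)^2)) + 2 * C * k^2 * T"
            by (simp add: H_def)
          ultimately show ?thesis using H0T c2 cd CT by linarith
        qed
        then show "energy (u 0) - energy (u (\<theta> xa / k)) \<le> k^2 * \<delta>" by (simp add: T_def)
      qed
    qed
  qed (use xa xa0 \<eta> in auto)
qed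

text \<open>Here \<open>xm\<close> maximises \<open>- f\<close>, so
  \<open>\<beta> xm = - f xm\<close>, and \<open>x1\<close> is found by halving the intercept.
  Choosing by intercept rather than by position avoids both a plateau of the maximum and an initial
  segment where \<open>f\<close> is linear and \<open>\<beta> = 0\<close>.\<close>

lemma profile_points:
  obtains x1 xm where "0 < x1" "x1 < xm" "xm < 1/2" "0 < \<beta> x1" "f1 x1 < 0" "- f x1 < - f xm"
proof -
  obtain xm where xm: "xm \<in> {0..1/2}" "\<And>x. x \<in> {0..1/2} \<Longrightarrow> - f x \<le> - f xm"
    using continuous_attains_sup[of "{0..1/2::real}" "\<lambda>x. - f x"] by (auto simp: continuous_intros)
  have F: "0 < - f xm" using xm(2)[of "1/4"] f_neg[of "1/4"] by simp
  have "f xm \<noteq> f 0" "f xm \<noteq> f (1/2)" using F f_0 f_half by auto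
  then have "xm \<noteq> 0" "xm \<noteq> 1/2" by metis+
  then have xm': "0 < xm" "xm < 1/2" using xm by auto
  have "- f1 xm = 0"
    by (rule interior_max_deriv_zero[of "\<lambda>x. - f x" "\<lambda>x. - f1 x" 0 xm "1/2"])
      (use xm xm' in \<open>auto intro!: derivative_eq_intros\<close>)
  then have fm: "f1 xm = 0" by simp
  have "\<exists>x1. 0 \<le> x1 \<and> x1 \<le> xm \<and> \<beta> x1 = - f xm / 2"
    by (rule IVT') (use xm' F fm f_0 in \<open>auto simp: \<beta>_def intro!: continuous_intros\<close>)
  then obtain x1 where x1: "0 \<le> x1" "x1 \<le> xm" "\<beta> x1 = - f xm / 2" by blast
  have "\<beta> x1 \<noteq> \<beta> 0" "\<beta> x1 \<noteq> \<beta> xm" using x1 F fm f_0 by (auto simp: \<beta>_def)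
  then have "x1 \<noteq> 0" "x1 \<noteq> xm" by metis+
  then have x1': "0 < x1" "x1 < xm" using x1 by auto
  have neg: "f1 x1 < 0"
  proof (rule ccontr)
    assume "\<not> f1 x1 < 0"
    then have "f1 x1 = 0" using f1_mono[of x1 xm] x1' xm' fm by auto
    then show False using tangent_line[of x1 xm] x1 x1' xm' F by auto
  qed
  have "- f x1 \<noteq> - f xm"
  proof
    assume eq: "- f x1 = - f xm"
    have "- f1 x1 = 0"
      by (rule interior_max_deriv_zero[of "\<lambda>x. - f x" "\<lambda>x. - f1 x" 0 x1 "1/2"])
        (use xm eq x1' xm' in \<open>auto intro!: derivative_eq_intros\<close>)
    then show False using neg by simp
  qed
  moreover have "- f x1 \<le> - f xm" using xm(2)[of x1] x1' xm' by auto
  ultimately have "- f x1 < - f xm" by simp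
  then show thesis using that[of x1 xm] x1' xm' x1 F neg by simp
qed

text \<open>A lower bound on the early loss from an upper bound on the late one: after time
  \<open>\<theta> x1 / k\<close> hardly more than \<open>V x1\<close> can be dissipated, yet almost
  nothing remains in the end.\<close>

lemma energy_dissipated:
  assumes x: "0 < x1" "x1 < 1/2" and \<beta>: "0 < \<beta> x1"
  obtains c where "0 < c"
    "\<forall>\<^sub>F k in at_top. \<forall>u ut ux uxx. solves k u ut ux uxx \<longrightarrow> k^2 * c \<le> energy (u 0) - energy (u (\<theta> x1 / k))"
proof -
  have "2/3 * f x1 * \<beta> x1 < 0" using f_neg[OF x] \<beta> by (simp add: mult_neg_pos)
  from DERIV_neg_dec_left[OF DERIV_V[OF x] this]
  obtain e where e: "0 < e" "\<And>h. 0 < h \<Longrightarrow> h < e \<Longrightarrow> V x1 < V (x1 - h)" by auto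
  define h where "h = min (e/2) (x1/2)"
  have h: "0 < h" "h < e" "h < x1" using e x by (auto simp: h_def)
  have "V x1 < V 0" using e(2)[of h] V_mono[of 0 "x1 - h"] h x by auto
  \<comment> \<open>One third pays for the error of the shock estimate, one for the energy left at
    the end, and one is the conclusion.\<close>
  define c where "c = (V 0 - V x1) / 3"
  have c: "0 < c" using \<open>V x1 < V 0\<close> by (simp add: c_def)
  obtain xb where xb: "x1 \<le> xb" "1/4 \<le> xb" "xb < 1/2"
    "\<forall>k u ut ux uxx. solves k u ut ux uxx \<longrightarrow> energy (u (\<theta> xb / k)) \<le> k^2 * c"
    by (rule energy_tail[OF x(2) c])
  show thesis
  proof (rule that[OF c])
    show "\<forall>\<^sub>F k in at_top. \<forall>u ut ux uxx. solves k u ut ux uxx \<longrightarrow> k^2 * c \<le> energy (u 0) - energy (u (\<theta> x1 / k))"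
      using energy_shock_loss[OF x(1) xb(1,3) \<beta> c]
    proof eventually_elim
      case (elim k)
      show ?case
      proof (intro allI impI)
        fix u ut ux uxx assume sol: "solves k u ut ux uxx"
        have "0 \<le> V xb" using V_nonneg[of xb] xb x by auto
        then have "0 \<le> k^2 * V xb" by simp
        moreover have "energy (u (\<theta> x1 / k)) - energy (u (\<theta> xb / k)) \<le> k^2 * (V x1 - V xb + c)"
          using elim sol by blast
        moreover note xb(4)[rule_format, OF sol] energy_init[OF sol]
        moreover have "3 * c = V 0 - V x1" by (simp add: c_def)
        then have "V 0 = V x1 + 3 * c" by linarith
        ultimately show "k^2 * c \<le> energy (u 0) - energy (u (\<theta> x1 / k))" by (simp add: algebra_simps)
      qed
    qed
  qed
qed

text \<open>If the enstrophy stayed below the level of a shock of maximal half-height, less energy would be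
  dissipated while the characteristics starting near the maximum of \<open>- f\<close> are absorbed than the
  inviscid solution loses, and the whole initial energy could not be used up.\<close>

lemma enstrophy_exceeds:
  assumes x1: "0 < x1" "x1 < xm" "xm < 1/2" "0 < \<beta> x1" "f1 x1 < 0" and m: "0 \<le> m" "m < 2/3 * (- f xm)^3"
  shows "\<forall>\<^sub>F k in at_top. \<forall>u ut ux uxx. solves k u ut ux uxx \<longrightarrow> (\<exists>t>0. m * k^3 < enstrophy (u t))"
proof -
  \<comment> \<open>A level strictly between \<open>m\<close> and the maximal shock level; by
    continuity the shock level stays above \<open>m'\<close> on an interval \<open>{xm..xd}\<close>,
    which creates a definite deficit.\<close>
  define m' where "m' = (m + 2/3 * (- f xm)^3) / 2"
  have m': "m < m'" "m' < 2/3 * (- f xm)^3" using m by (auto simp: m'_def)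
  have "((\<lambda>x. 2/3 * (- f x)^3) \<longlongrightarrow> 2/3 * (- f xm)^3) (at xm)"
    by (intro tendsto_intros isContD DERIV_isCont[OF df])
  then have "\<forall>\<^sub>F x in at xm. m' < 2/3 * (- f x)^3" using m'(2) by (rule order_tendstoD)
  then obtain d where d: "0 < d" "\<And>x. x \<noteq> xm \<Longrightarrow> dist x xm < d \<Longrightarrow> m' < 2/3 * (- f x)^3"
    by (auto simp: eventually_at)
  define xd where "xd = xm + min (d/2) ((1/2 - xm)/2)"
  have xd: "xm < xd" "xd < 1/2" "xd < xm + d" using d x1 by (auto simp: xd_def min_def field_simps)
  have near: "m' < 2/3 * (- f x)^3" if "xm \<le> x" "x \<le> xd" for x
    using d(2)[of x] m'(2) that xd by (cases "x = xm") (auto simp: dist_real_def)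
  have x1h: "x1 < 1/2" and \<beta>m: "0 < \<beta> xm" and \<beta>d: "0 < \<beta> xd"
    using x1 xd \<beta>_mono[of x1 xm] \<beta>_mono[of x1 xd] by auto
  have \<theta>d: "\<theta> xm < \<theta> xd"
  proof (rule DERIV_pos_imp_increasing[OF xd(1)])
    fix x assume x: "xm \<le> x" "x \<le> xd"
    then have "0 < x" "x < 1/2" "0 < \<beta> x" using x1 xd \<beta>_mono[of x1 x] by auto
    then show "\<exists>y. (\<theta> has_real_derivative y) (at x) \<and> 0 < y"
      using DERIV_\<theta>[of x] f_neg[of x] by (intro exI[of _ "\<beta> x / (2 * (f x)^2)"]) auto
  qed
  have Vd: "2 * m' * (\<theta> xd - \<theta> xm) \<le> V xm - V xd"
  proof -
    have "- V xm - 2 * m' * \<theta> xm \<le> - V xd - 2 * m' * \<theta> xd"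
    proof (rule DERIV_nonneg_imp_nondecreasing[of xm xd "\<lambda>x. - V x - 2 * m' * \<theta> x"])
      fix x assume x: "xm \<le> x" "x \<le> xd"
      then have x': "0 < x" "x < 1/2" using x1 xd by auto
      define \<theta>' where "\<theta>' = \<beta> x / (2 * (f x)^2)"
      have "0 \<le> \<theta>'" using \<beta>_nonneg[of x] x' by (simp add: \<theta>'_def)
      then have "0 \<le> (2/3 * (- f x)^3 - m') * (2 * \<theta>')" using near[OF x] by (intro mult_nonneg_nonneg) auto
      moreover have "2/3 * f x * \<beta> x = - 4/3 * (- f x)^3 * \<theta>'"
        using f_neg[OF x'] by (simp add: \<theta>'_def field_simps power2_eq_square power3_eq_cube)
      ultimately have "0 \<le> - (2/3 * f x * \<beta> x) - 2 * m' * \<theta>'" by (simp add: algebra_simps)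
      moreover have "((\<lambda>x. - V x - 2 * m' * \<theta> x) has_real_derivative - (2/3 * f x * \<beta> x) - 2 * m' * \<theta>') (at x)"
        unfolding \<theta>'_def by (intro DERIV_diff DERIV_minus DERIV_cmult DERIV_V DERIV_\<theta> x')
      ultimately show "\<exists>y. ((\<lambda>x. - V x - 2 * m' * \<theta> x) has_real_derivative y) (at x) \<and> 0 \<le> y" by blast
    qed (use xd in auto)
    then show ?thesis by (simp add: algebra_simps)
  qed
  \<comment> \<open>Four errors arise: the early loss, the two outer shock ranges and the tail.
    Together they amount to half of the deficit
    \<open>2 * (m' - m) * (\<theta> xd - \<theta> xm)\<close>.\<close>
  define \<epsilon> where "\<epsilon> = (m' - m) * (\<theta> xd - \<theta> xm) / 4"
  have \<epsilon>: "0 < \<epsilon>" using m' \<theta>d by (simp add: \<epsilon>_def)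
  obtain xa where xa: "0 < xa" "xa \<le> x1" "0 < \<beta> xa" and early:
    "\<forall>\<^sub>F k in at_top. \<forall>u ut ux uxx. solves k u ut ux uxx \<longrightarrow> energy (u 0) - energy (u (\<theta> xa / k)) \<le> k^2 * \<epsilon>"
    by (rule early_energy_loss[OF x1(1) x1h x1(4,5) \<epsilon>])
  obtain xb where xb: "xd \<le> xb" "1/4 \<le> xb" "xb < 1/2"
    "\<forall>k u ut ux uxx. solves k u ut ux uxx \<longrightarrow> energy (u (\<theta> xb / k)) \<le> k^2 * \<epsilon>"
    by (rule energy_tail[OF xd(2) \<epsilon>])
  have xam: "xa \<le> xm" using xa x1 by simp
  have xd0: "0 < xd" using xd x1 by simp
  show ?thesis
    using early energy_shock_loss[OF xa(1) xam x1(3) xa(3) \<epsilon>]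
      energy_shock_loss[OF xd0 xb(1,3) \<beta>d \<epsilon>] eventually_gt_at_top[of 0]
  proof eventually_elim
    case (elim k)
    show ?case
    proof (intro allI impI)
      fix u ut ux uxx assume sol: "solves k u ut ux uxx"
      interpret odd_convex_burgers f f1 f2 u ut ux uxx k by fact
      show "\<exists>t>0. m * k^3 < enstrophy (u t)"
      proof (rule ccontr)
        assume "\<not> (\<exists>t>0. m * k^3 < enstrophy (u t))"
        then have small: "enstrophy (u t) \<le> m * k^3" if "0 < t" for t using that by force
        have \<theta>m: "0 < \<theta> xm" using \<theta>_pos[of xm] x1 by auto
        have "energy (u (\<theta> xm / k)) + 2 * (m * k^3) * (\<theta> xm / k) \<le> energy (u (\<theta> xd / k)) + 2 * (m * k^3) * (\<theta> xd / k)"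
        proof (rule DERIV_nonneg_imp_nondecreasing[of _ _ "\<lambda>t. energy (u t) + 2 * (m * k^3) * t"])
          show "\<theta> xm / k \<le> \<theta> xd / k" using \<theta>d k_pos by (intro divide_right_mono) auto
          fix t assume "\<theta> xm / k \<le> t"
          moreover have "0 < \<theta> xm / k" using \<theta>m k_pos by simp
          ultimately have t: "0 < t" by linarith
          have "((\<lambda>t. energy (u t) + 2 * (m * k^3) * t) has_real_derivative - 2 * enstrophy (u t) + 2 * (m * k^3) * 1) (at t)"
            by (intro DERIV_add DERIV_energy DERIV_cmult DERIV_ident t)
          moreover have "0 \<le> - 2 * enstrophy (u t) + 2 * (m * k^3) * 1" using small[OF t] by simp
          ultimately show "\<exists>y. ((\<lambda>t. energy (u t) + 2 * (m * k^3) * t) has_real_derivative y) (at t) \<and> 0 \<le> y" by blast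
        qed
        moreover have "2 * (m * k^3) * (\<theta> xd / k) - 2 * (m * k^3) * (\<theta> xm / k) = k^2 * (2 * m * (\<theta> xd - \<theta> xm))"
          using k_pos by (simp add: field_simps power2_eq_square power3_eq_cube)
        ultimately have mid: "energy (u (\<theta> xm / k)) - energy (u (\<theta> xd / k)) \<le> k^2 * (2 * m * (\<theta> xd - \<theta> xm))" by linarith
        have "energy (u 0) - energy (u (\<theta> xa / k)) \<le> k^2 * \<epsilon>"
          "energy (u (\<theta> xa / k)) - energy (u (\<theta> xm / k)) \<le> k^2 * (V xa - V xm + \<epsilon>)"
          "energy (u (\<theta> xd / k)) - energy (u (\<theta> xb / k)) \<le> k^2 * (V xd - V xb + \<epsilon>)"
          using elim sol by blast+
        with mid xb(4)[rule_format, OF sol] energy_init[OF sol]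
        have "k^2 * V 0 \<le> k^2 * \<epsilon> + k^2 * (V xa - V xm + \<epsilon>) + k^2 * (2 * m * (\<theta> xd - \<theta> xm)) + k^2 * (V xd - V xb + \<epsilon>) + k^2 * \<epsilon>"
          by linarith
        also have "\<dots> = k^2 * (4 * \<epsilon> + V xa - (V xm - V xd) - V xb + 2 * m * (\<theta> xd - \<theta> xm))" by (simp add: algebra_simps)
        finally have "V 0 \<le> 4 * \<epsilon> + V xa - (V xm - V xd) - V xb + 2 * m * (\<theta> xd - \<theta> xm)" using k_pos by simp
        moreover have "V xa \<le> V 0" using V_mono[of 0 xa] xa x1 by auto
        moreover have "0 \<le> V xb" using V_nonneg[of xb] xb xd0 by auto
        moreover note Vd
        moreover have "4 * \<epsilon> + 2 * m * (\<theta> xd - \<theta> xm) < 2 * m' * (\<theta> xd - \<theta> xm)"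
        proof -
          have "0 < (m' - m) * (\<theta> xd - \<theta> xm)" using m' \<theta>d by simp
          moreover have "4 * \<epsilon> = (m' - m) * (\<theta> xd - \<theta> xm)" by (simp add: \<epsilon>_def)
          ultimately show ?thesis by (simp add: algebra_simps)
        qed
        ultimately show False by linarith
      qed
    qed
  qed
qed

text \<open>Before \<open>\<tau> / k\<close> the single tangent line at \<open>x1\<close> keeps the
  enstrophy below \<open>m * k^3\<close>, and after \<open>\<Theta> / k\<close> decay does. Since
  that level is exceeded somewhere, the maximum over the compact interval between is global for
  positive times.\<close>

lemma enstrophy_maximum:
  obtains \<tau> \<Theta> m M c where "0 < \<tau>" "0 < \<Theta>" "0 < m" "0 < M" "0 < c"
    "\<forall>\<^sub>F k in at_top. \<forall>u ut ux uxx. solves k u ut ux uxx \<longrightarrow>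
      (\<exists>T. \<tau> / k \<le> T \<and> T \<le> \<Theta> / k \<and> (\<forall>t>0. enstrophy (u t) \<le> enstrophy (u T)) \<and>
        m * k^3 \<le> enstrophy (u T) \<and> enstrophy (u T) \<le> M * k^3 \<and>
        c * k^2 \<le> energy (u T) \<and> c * k^2 \<le> energy (u 0) - energy (u T))"
proof -
  obtain x1 xm where x: "0 < x1" "x1 < xm" "xm < 1/2" "0 < \<beta> x1" "f1 x1 < 0" "- f x1 < - f xm"
    by (rule profile_points)
  have x1: "x1 < 1/2" using x by simp
  define g where "g = - f x1"
  define G where "G = - f xm"
  have g: "0 < g" "g < G" using f_neg[OF x(1) x1] x by (auto simp: g_def G_def)
  then have gG: "g^3 < G^3" by (intro power_strict_mono) auto
  \<comment> \<open>Halfway between the shock levels \<open>2/3 * g^3\<close> and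
    \<open>2/3 * G^3\<close>; the half gap is the tolerance \<open>\<epsilon>\<close> of the early
    bound.\<close>
  define m where "m = 2/3 * g^3 + (G^3 - g^3) / 3"
  define \<epsilon> where "\<epsilon> = (G^3 - g^3) / 3"
  have \<epsilon>: "0 < \<epsilon>" using gG by (simp add: \<epsilon>_def)
  have m: "0 < m" "m < 2/3 * G^3" "m = 2/3 * g^3 + \<epsilon>"
    using g gG by (auto simp: m_def \<epsilon>_def field_simps intro!: add_pos_pos)
  define \<tau> where "\<tau> = \<theta> x1"
  have \<tau>: "0 < \<tau>" using \<theta>_pos[OF x(1) x1] by (simp add: \<tau>_def)
  define M where "M = 43 * L^3 + 9 * L^2"
  have M: "0 < M" using L_pos by (simp add: M_def add_pos_pos)
  \<comment> \<open>The last summand, with \<open>\<Theta> \<ge> 1\<close>, makes the late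
    coefficient \<open>16 / (3 * \<Theta>^3)\<close> at most \<open>m / 2\<close>; the other half of
    \<open>m\<close> absorbs the terms of order \<open>k^2\<close>.\<close>
  define \<Theta> where "\<Theta> = \<tau> + 1 + 32 / (3 * m)"
  have \<Theta>: "1 \<le> \<Theta>" "\<tau> \<le> \<Theta>" "32 / (3 * m) \<le> \<Theta>" using \<tau> m by (auto simp: \<Theta>_def)
  have \<Theta>3: "16 / (3 * \<Theta>^3) \<le> m / 2"
  proof -
    have "32 / (3 * m) \<le> \<Theta>^3" using \<Theta> self_le_power[of \<Theta> 3] by simp
    then have "32 \<le> \<Theta>^3 * (3 * m)" using m(1) by (simp add: pos_divide_le_eq)
    moreover have "0 < 3 * \<Theta>^3" using \<Theta>(1) by simp
    ultimately show ?thesis by (simp add: pos_divide_le_eq mult.left_commute mult.commute)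
  qed
  obtain c0 where c0: "0 < c0" and diss:
    "\<forall>\<^sub>F k in at_top. \<forall>u ut ux uxx. solves k u ut ux uxx \<longrightarrow> k^2 * c0 \<le> energy (u 0) - energy (u (\<theta> x1 / k))"
    using energy_dissipated[OF x(1) x1 x(4)] by blast
  \<comment> \<open>The value of the lower energy bound at enstrophy \<open>m * k^3\<close>, with
    the factor \<open>k^2\<close> taken out.\<close>
  define c1 where "c1 = (m / (17 * L^2))^3 / (3 * L)"
  have c1: "0 < c1" using m L_pos by (simp add: c1_def)
  define c where "c = min c0 c1"
  show thesis
  proof (rule that[of \<tau> \<Theta> m M c])
    show "\<forall>\<^sub>F k in at_top. \<forall>u ut ux uxx. solves k u ut ux uxx \<longrightarrow>
      (\<exists>T. \<tau> / k \<le> T \<and> T \<le> \<Theta> / k \<and> (\<forall>t>0. enstrophy (u t) \<le> enstrophy (u T)) \<and>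
        m * k^3 \<le> enstrophy (u T) \<and> enstrophy (u T) \<le> M * k^3 \<and>
        c * k^2 \<le> energy (u T) \<and> c * k^2 \<le> energy (u 0) - energy (u T))"
      using diss enstrophy_shock_bound[OF x(1) order_refl x1 x(4) \<epsilon>]
        enstrophy_exceeds[OF x(1-5) less_imp_le[OF m(1)] m(2)[unfolded G_def]]
        eventually_ge_at_top[of 1] eventually_ge_at_top[of "1 / L"] eventually_ge_at_top[of "2 * \<Theta>"]
        eventually_ge_at_top[of "18 * L^2 / m"]
    proof eventually_elim
      case (elim k)
      show ?case
      proof (intro allI impI)
        fix u ut ux uxx assume sol: "solves k u ut ux uxx"
        interpret odd_convex_burgers f f1 f2 u ut ux uxx k by fact
        have kL: "1 \<le> k * L" using elim(5) L_pos by (simp add: pos_divide_le_eq)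
        have k3: "k^2 * (9 * L^2) \<le> m / 2 * k^3"
        proof -
          have "9 * L^2 \<le> m / 2 * k" using elim(7) m by (simp add: pos_divide_le_eq algebra_simps)
          then have "k^2 * (9 * L^2) \<le> k^2 * (m / 2 * k)" by (intro mult_left_mono) auto
          then show ?thesis by (simp add: power2_eq_square power3_eq_cube algebra_simps)
        qed
        have early: "enstrophy (u t) \<le> m * k^3" if t: "0 < t" "t \<le> \<tau> / k" for t
        proof -
          have "k * t \<in> {0<..\<theta> x1}" using t k_pos by (auto simp: \<tau>_def pos_le_divide_eq ac_simps)
          then have "enstrophy (u ((k * t) / k)) \<le> k^3 * (2/3 * (- f x1)^3 + \<epsilon>)"
            using elim(2)[rule_format, OF sol, of x1 "k * t"] x(5) by simp
          then show ?thesis using k_pos by (simp add: m(3) g_def mult.commute)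
        qed
        have late: "enstrophy (u t) \<le> m * k^3" if t: "\<Theta> / k \<le> t" for t
        proof -
          have "enstrophy (u t) \<le> 16 / (3 * \<Theta>^3) * k^3 + 9 * L^2 * k^2"
            using \<Theta> t elim kL by (intro enstrophy_late) auto
          also have "\<dots> \<le> m / 2 * k^3 + m / 2 * k^3"
            using \<Theta>3 k3 k_pos by (intro add_mono mult_right_mono) (auto simp: ac_simps)
          finally show ?thesis by simp
        qed
        obtain t0 where t0: "0 < t0" "m * k^3 < enstrophy (u t0)" using elim(3) sol by blast
        have t0i: "t0 \<in> {\<tau> / k..\<Theta> / k}" using early[of t0] late[of t0] t0 by (meson atLeastAtMost_iff linorder_le_cases not_less)
        have tk: "0 < \<tau> / k" using \<tau> k_pos by simp
        have "continuous_on {\<tau> / k..\<Theta> / k} (\<lambda>t. enstrophy (u t))"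
          by (rule continuous_on_subset[OF continuous_on_enstrophy]) (use tk in auto)
        then obtain T where T: "T \<in> {\<tau> / k..\<Theta> / k}"
          and mx: "\<And>t. t \<in> {\<tau> / k..\<Theta> / k} \<Longrightarrow> enstrophy (u t) \<le> enstrophy (u T)"
          using continuous_attains_sup[of "{\<tau> / k..\<Theta> / k}" "\<lambda>t. enstrophy (u t)"] t0i by auto
        have T0: "0 < T" using T tk by auto
        have big: "m * k^3 < enstrophy (u T)" using mx[OF t0i] t0 by simp
        have "enstrophy (u t) \<le> enstrophy (u T)" if "0 < t" for t
          using early[OF that] late[of t] mx[of t] big by fastforce
        moreover have "enstrophy (u T) \<le> M * k^3" unfolding M_def using T0 elim(4) kL by (intro enstrophy_upper) auto
        moreover have "c * k^2 \<le> energy (u T)"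
        proof -
          have "c1 * k^2 = (m * k^3 / (17 * (k * L)^2))^3 / (3 * (k * L))"
            using k_pos L_pos by (simp add: c1_def power_divide power_mult_distrib field_simps eval_nat_numeral)
          also have "\<dots> \<le> (enstrophy (u T) / (17 * (k * L)^2))^3 / (3 * (k * L))"
            using big k_pos L_pos m by (intro divide_right_mono power_mono) auto
          also have "\<dots> \<le> energy (u T)" using T0 kL by (rule energy_lower)
          finally have "c1 * k^2 \<le> energy (u T)" .
          moreover have "c * k^2 \<le> c1 * k^2" by (intro mult_right_mono) (auto simp: c_def)
          ultimately show ?thesis by simp
        qed
        moreover have "c * k^2 \<le> energy (u 0) - energy (u T)"
        proof -
          have "c * k^2 \<le> c0 * k^2" by (intro mult_right_mono) (auto simp: c_def)
          also have "c0 * k^2 \<le> energy (u 0) - energy (u (\<theta> x1 / k))" using elim(1) sol by (auto simp: mult.commute)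
          also have "\<dots> \<le> energy (u 0) - energy (u T)"
            using energy_antimono[of "\<tau> / k" T] T tk by (simp add: \<tau>_def)
          finally show ?thesis .
        qed
        ultimately show "\<exists>T. \<tau> / k \<le> T \<and> T \<le> \<Theta> / k \<and> (\<forall>t>0. enstrophy (u t) \<le> enstrophy (u T)) \<and>
          m * k^3 \<le> enstrophy (u T) \<and> enstrophy (u T) \<le> M * k^3 \<and>
          c * k^2 \<le> energy (u T) \<and> c * k^2 \<le> energy (u 0) - energy (u T)"
          using T big by (intro exI[of _ T]) auto
      qed
    qed
  qed (use \<tau> \<Theta> m M c0 c1 in \<open>auto simp: c_def\<close>)
qed

end

subsection \<open>The maximum of the enstrophy\<close>

lemma C3_per_derivatives:
  assumes "f \<in> C3_per"
  shows "(f has_real_derivative deriv f x) (at x)" "(deriv f has_real_derivative deriv (deriv f) x) (at x)"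
    "continuous_on UNIV (deriv (deriv f))"
proof -
  have d: "(deriv ^^ j) f differentiable (at x)" if "j < 3" for j x using assms that by (auto simp: C3_per_def)
  show "(f has_real_derivative deriv f x) (at x)"
    using d[of 0 x] by (simp add: DERIV_deriv_iff_real_differentiable)
  show "(deriv f has_real_derivative deriv (deriv f) x) (at x)"
    using d[of 1 x] by (simp add: DERIV_deriv_iff_real_differentiable)
  have "deriv (deriv f) differentiable (at x)" for x using d[of 2 x] by (simp add: numeral_2_eq_2)
  then show "continuous_on UNIV (deriv (deriv f))"
    by (auto intro!: continuous_at_imp_continuous_on differentiable_imp_continuous_within)
qed

lemma burgers_solution_odd_convex:
  assumes "odd_convex_profile f f1 f2" and "burgers_solution (\<lambda>x. k * f x) u" and "0 < k"
  obtains ut ux uxx where "odd_convex_burgers f f1 f2 u ut ux uxx k"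
proof -
  obtain ut ux uxx where *: "continuous_on ({0<..} \<times> UNIV) (\<lambda>(t, x). ut t x)"
      "continuous_on ({0<..} \<times> UNIV) (\<lambda>(t, x). ux t x)"
      "continuous_on ({0<..} \<times> UNIV) (\<lambda>(t, x). uxx t x)"
      "\<forall>t>0. \<forall>x. ((\<lambda>s. u s x) has_real_derivative ut t x) (at t) \<and>
           (u t has_real_derivative ux t x) (at x) \<and>
           (ux t has_real_derivative uxx t x) (at x) \<and>
           ut t x + 2 * u t x * ux t x = uxx t x"
    using assms(2) unfolding burgers_solution_def by blast
  have per: "u t (x + 1) = u t x" if "0 \<le> t" for t x
    using assms(2) that periodic_fun_simple'.plus_period[of "u t" x] by (auto simp: burgers_solution_def)
  have "burgers u ut ux uxx"
  proof
    fix t x :: real assume "0 < t"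
    with *(4) have "ut t x + 2 * u t x * ux t x = uxx t x" by blast
    then show "ut t x = uxx t x - 2 * u t x * ux t x" by linarith
  qed (use * per assms(2) in \<open>auto simp: burgers_solution_def\<close>)
  moreover have "u 0 x = k * f x" for x using assms(2) by (simp add: burgers_solution_def)
  ultimately show thesis
    using that assms(1,3) by (auto simp: odd_convex_burgers_def odd_convex_burgers_axioms_def)
qed

lemma (in odd_convex_profile) enstrophy_initial:
  "enstrophy (\<lambda>x. k * f x) = k^2 * enstrophy f" "0 < enstrophy f"
proof -
  have d1: "deriv (\<lambda>x. k * f x) = (\<lambda>x. k * f1 x)"
    by (rule ext, rule DERIV_imp_deriv) (auto intro!: derivative_eq_intros)
  have d2: "deriv f = f1" by (rule ext, rule DERIV_imp_deriv, rule df)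
  show "enstrophy (\<lambda>x. k * f x) = k^2 * enstrophy f"
    unfolding enstrophy_def d1 d2 by (simp add: power_mult_distrib)
  have "integral (cbox (-1/2) (1/2)) (\<lambda>x. (f1 x)^2) \<noteq> 0"
  proof
    assume "integral (cbox (-1/2) (1/2)) (\<lambda>x. (f1 x)^2) = 0"
    then have "\<forall>x\<in>cbox (-1/2) (1/2). (f1 x)^2 = 0"
      by (subst (asm) integral_cbox_eq_0_iff) (auto intro!: continuous_intros)
    then show False using f1_0_neg by auto
  qed
  moreover have "0 \<le> integral (cbox (-1/2) (1/2)) (\<lambda>x. (f1 x)^2)"
    by (rule integral_nonneg) (auto intro!: integrable_continuous_interval continuous_intros)
  ultimately show "0 < enstrophy f" unfolding enstrophy_def d2 by simp
qed

theorem theorem1: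
  fixes f :: "real \<Rightarrow> real"
  assumes "f \<in> C3_per"
    and "\<forall>x. f (- x) = - f x"
    and "\<exists>x. f x \<noteq> 0"
    and "\<forall>x\<in>{0..1/2}. (deriv ^^ 2) f x \<ge> 0"
  shows "\<exists>k0 Cm Cp :: real. k0 > 0 \<and> 0 < Cm \<and> Cm < Cp \<and>
    (\<forall>k\<ge>k0. \<forall>u E0. burgers_solution (\<lambda>x. k * f x) u \<and> E0 = enstrophy (\<lambda>x. k * f x) \<longrightarrow>
       Cm * k\<^sup>2 \<le> E0 \<and> E0 \<le> Cp * k\<^sup>2 \<and>
       (\<exists>T>0.
          (\<forall>t\<ge>0. enstrophy (u t) \<le> enstrophy (u T)) \<and>
          Cm * E0 powr (-1/2) \<le> T \<and> T \<le> Cp * E0 powr (-1/2) \<and>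
          Cm * E0 powr (3/2) \<le> enstrophy (u T) \<and> enstrophy (u T) \<le> Cp * E0 powr (3/2) \<and>
          Cm * E0 \<le> energy (u T) \<and> energy (u T) \<le> Cp * E0 \<and>
          Cm * E0 \<le> energy (u 0) - energy (u T) \<and>
          energy (u 0) - energy (u T) \<le> Cp * E0))"
proof -
  interpret odd_convex_profile f "deriv f" "deriv (deriv f)"
  proof
    show "f (x + 1) = f x" for x
      using assms(1) periodic_fun_simple'.plus_period[of f x] by (simp add: C3_per_def)
    show "0 \<le> deriv (deriv f) x" if "0 \<le> x" "x \<le> 1/2" for x
      using assms(4) that by (simp add: numeral_2_eq_2)
  qed (use assms C3_per_derivatives in auto)
  define e where "e = enstrophy f"
  have e: "0 < e" using enstrophy_initial(2) by (simp add: e_def)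
  \<comment> \<open>As the initial enstrophy is \<open>k^2 * e\<close>, its powers
    \<open>-1/2\<close> and \<open>3/2\<close> are \<open>p / k\<close> and
    \<open>q * k^3\<close>.\<close>
  define p where "p = e powr (-1/2)"
  define q where "q = e powr (3/2)"
  have pq: "0 < p" "0 < q" using e by (auto simp: p_def q_def)
  obtain \<tau> \<Theta> m M c where pos: "0 < \<tau>" "0 < \<Theta>" "0 < m" "0 < M" "0 < c" and ev:
    "\<forall>\<^sub>F k in at_top. \<forall>u ut ux uxx. solves k u ut ux uxx \<longrightarrow>
      (\<exists>T. \<tau> / k \<le> T \<and> T \<le> \<Theta> / k \<and> (\<forall>t>0. enstrophy (u t) \<le> enstrophy (u T)) \<and>
        m * k^3 \<le> enstrophy (u T) \<and> enstrophy (u T) \<le> M * k^3 \<and>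
        c * k^2 \<le> energy (u T) \<and> c * k^2 \<le> energy (u 0) - energy (u T))"
    by (rule enstrophy_maximum)
  obtain k1 where k1: "\<forall>k\<ge>k1. \<forall>u ut ux uxx. solves k u ut ux uxx \<longrightarrow>
      (\<exists>T. \<tau> / k \<le> T \<and> T \<le> \<Theta> / k \<and> (\<forall>t>0. enstrophy (u t) \<le> enstrophy (u T)) \<and>
        m * k^3 \<le> enstrophy (u T) \<and> enstrophy (u T) \<le> M * k^3 \<and>
        c * k^2 \<le> energy (u T) \<and> c * k^2 \<le> energy (u 0) - energy (u T))"
    using ev unfolding eventually_at_top_linorder by blast
  \<comment> \<open>The entry \<open>e / m\<close> puts the initial enstrophy \<open>k^2 * e\<close>
    below \<open>m * k^3\<close>.\<close>
  define k0 where "k0 = Max {1, k1, e / m}"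
  define Cm where "Cm = Min {e, \<tau> / p, m / q, c / e}"
  define C where "C = Max {e, \<Theta> / p, M / q, V 0 / e}"
  define Cp where "Cp = C + Cm"
  have Cm: "0 < Cm" "Cm \<le> e" "Cm * p \<le> \<tau>" "Cm * q \<le> m" "Cm * e \<le> c"
    using pos pq e by (auto simp: Cm_def pos_le_divide_eq[symmetric])
  have Cp: "Cm < Cp" "e \<le> Cp" "\<Theta> \<le> Cp * p" "M \<le> Cp * q" "V 0 \<le> Cp * e"
  proof -
    have C: "e \<le> C" "\<Theta> / p \<le> C" "M / q \<le> C" "V 0 / e \<le> C" by (auto simp: C_def)
    then have "\<Theta> / p \<le> Cp" "M / q \<le> Cp" "V 0 / e \<le> Cp" using Cm(1) by (auto simp: Cp_def)
    then show "\<Theta> \<le> Cp * p" "M \<le> Cp * q" "V 0 \<le> Cp * e" using pq e by (auto simp: pos_divide_le_eq)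
    show "Cm < Cp" "e \<le> Cp" using C(1) e Cm(1) by (auto simp: Cp_def)
  qed
  show ?thesis
  proof (rule exI[of _ k0], rule exI[of _ Cm], rule exI[of _ Cp], intro conjI allI impI)
    show "0 < k0" by (simp add: k0_def less_max_iff_disj)
    show "0 < Cm" "Cm < Cp" by (fact Cm(1), fact Cp(1))
    fix k u E0 assume k: "k0 \<le> k" and *: "burgers_solution (\<lambda>x. k * f x) u \<and> E0 = enstrophy (\<lambda>x. k * f x)"
    have k': "1 \<le> k" "k1 \<le> k" "e / m \<le> k" using k by (auto simp: k0_def)
    have kp: "0 < k" using k' by simp
    have E0: "E0 = k^2 * e" using * enstrophy_initial(1) by (simp add: e_def)
    show "Cm * k^2 \<le> E0" "E0 \<le> Cp * k^2"
      using Cm(2) Cp(2) by (auto simp: E0 mult.commute[of "k^2"] intro!: mult_right_mono)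
    obtain ut ux uxx where sol: "solves k u ut ux uxx"
      using burgers_solution_odd_convex[OF _ conjunct1[OF *] kp] odd_convex_profile_axioms by blast
    interpret B: odd_convex_burgers f "deriv f" "deriv (deriv f)" u ut ux uxx k by (fact sol)
    obtain T where T: "\<tau> / k \<le> T" "T \<le> \<Theta> / k" "\<forall>t>0. enstrophy (u t) \<le> enstrophy (u T)"
        "m * k^3 \<le> enstrophy (u T)" "enstrophy (u T) \<le> M * k^3"
        "c * k^2 \<le> energy (u T)" "c * k^2 \<le> energy (u 0) - energy (u T)"
      using k1 k'(2) sol by blast
    have T0: "0 < T" using T(1) pos kp by (smt (verit) divide_pos_pos)
    have p: "E0 powr (-1/2) = p / k" and q: "E0 powr (3/2) = q * k^3"
    proof -
      have "(k^2) powr s = k powr (2 * s)" for s using powr_powr[of k 2 s] kp by simp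
      then have "E0 powr s = k powr (2 * s) * e powr s" for s
        using kp e by (simp add: E0 powr_mult)
      from this[of "-1/2"] this[of "3/2"] show "E0 powr (-1/2) = p / k" "E0 powr (3/2) = q * k^3"
        using kp by (auto simp: p_def q_def powr_minus_divide powr_numeral)
    qed
    have "enstrophy (u t) \<le> enstrophy (u T)" if "0 \<le> t" for t
    \<comment> \<open>The maximum was taken over positive times, and continuity of the enstrophy has
      been shown only there, so the initial value is compared separately through its order
      \<open>k^2\<close>.\<close>
    proof (cases "t = 0")
      case True
      have "u 0 = (\<lambda>x. k * f x)" by (rule ext) (rule B.init)
      then have "enstrophy (u 0) = k^2 * e" using enstrophy_initial(1) by (simp add: e_def)
      also have "\<dots> \<le> k^2 * (m * k)" using k'(3) pos by (intro mult_left_mono) (auto simp: pos_divide_le_eq mult.commute)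
      also have "\<dots> = m * k^3" by (simp add: power2_eq_square power3_eq_cube)
      also have "\<dots> \<le> enstrophy (u T)" by (rule T(4))
      finally show ?thesis using True by simp
    next
      case False then show ?thesis using T(3) that by auto
    qed
    moreover have "Cm * (p / k) \<le> T"
      using divide_right_mono[OF Cm(3), of k] T(1) kp by simp
    moreover have "T \<le> Cp * (p / k)"
      using divide_right_mono[OF Cp(3), of k] T(2) kp by simp
    moreover have "Cm * (q * k^3) \<le> enstrophy (u T)"
      using order_trans[OF mult_right_mono[OF Cm(4)] T(4)] kp by (simp add: mult.assoc)
    moreover have "enstrophy (u T) \<le> Cp * (q * k^3)"
      using order_trans[OF T(5) mult_right_mono[OF Cp(4)]] kp by (simp add: mult.assoc)
    moreover have lo: "Cm * E0 \<le> c * k^2"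
      using mult_right_mono[OF Cm(5), of "k^2"] by (simp add: E0 ac_simps)
    moreover have hi: "energy (u 0) \<le> Cp * E0"
      using mult_right_mono[OF Cp(5), of "k^2"] energy_init[OF sol] by (simp add: E0 ac_simps)
    moreover have "0 \<le> c * k^2" using pos by simp
    ultimately show "\<exists>T>0. (\<forall>t\<ge>0. enstrophy (u t) \<le> enstrophy (u T)) \<and>
          Cm * E0 powr (-1/2) \<le> T \<and> T \<le> Cp * E0 powr (-1/2) \<and>
          Cm * E0 powr (3/2) \<le> enstrophy (u T) \<and> enstrophy (u T) \<le> Cp * E0 powr (3/2) \<and>
          Cm * E0 \<le> energy (u T) \<and> energy (u T) \<le> Cp * E0 \<and>
          Cm * E0 \<le> energy (u 0) - energy (u T) \<and>
          energy (u 0) - energy (u T) \<le> Cp * E0"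
      unfolding p q using T(6,7) T0 by (intro exI[of _ T] conjI) auto
  qed
qed

end
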